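(* Let $q$ be a prime power, $n,d$ positive integers and $\epsilon>0$. (i) If $\epsilon>4\left(d(d-1)/2+1\right)/q$, then there is a $(1-\epsilon)$-dense $(n,q,d)$-perfect hash family of size $$O\left(\frac{d^2\log n}{\epsilon\log\left(\epsilon q/\left(e\,(d(d-1)/2+1)\right)\right)}\right)$$ that can be constructed in linear time. (ii) If $\left(d(d-1)/2+1\right)/(q-1)\le\epsilon\le 4\left(d(d-1)/2+1\right)/q$, then there is a $(1-\epsilon)$-dense $(n,q,d)$-perfect hash family of size $$O\left(\frac{q^2d^2\log n}{\epsilon\left(q-(d(d-1)/2+1)/\epsilon\right)^2}\right)$$ that can be constructed in linear time.
   Context: For $d\le q$, a family $H$ of functions $h:[n]\to[q]$ is a $(1-\epsilon)$-dense $(n,q,d)$-perfect hash family if for every subset $S\subseteq[n]$ with $|S|=d$ there are at least $(1-\epsilon)|H|$ functions $h\in H$ whose restriction to $S$ is injective. The size of the family is $|H|$. "Constructed in linear time" means a deterministic algorithm outputs the family in time linear in the size of its description (number of functions times $n$). *)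

theory Defs
  imports Complex_Main "HOL-Library.FuncSet" "HOL-Number_Theory.Prime_Powers"
begin

section \<open>Dense perfect hash families\<close>

text \<open>
  The sets of size n and q are rendered as \<open>{..<n}\<close> and \<open>{..<q}\<close>. A family is a list of
  functions: functions are counted with multiplicity, and the size of the family is its length.
  The empty family, which would satisfy the density condition vacuously, is excluded.
\<close>

definition dense_phf :: "real \<Rightarrow> nat \<Rightarrow> nat \<Rightarrow> nat \<Rightarrow> (nat \<Rightarrow> nat) list \<Rightarrow> bool" where
  "dense_phf \<delta> n q d H \<longleftrightarrow>
     H \<noteq> [] \<and>
     (\<forall>h\<in>set H. h \<in> {..<n} \<rightarrow> {..<q}) \<and>
     (\<forall>S\<subseteq>{..<n}. card S = d \<longrightarrow>
        real (length (filter (\<lambda>h. inj_on h S) H)) \<ge> \<delta> * real (length H))"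

section \<open>The machine model\<close>

text \<open>
  Deterministic programs for a word RAM extended by exact real cells (a real RAM). There are two
  random access memories, one of natural numbers (words) and one of reals, and a write-only
  output sequence of words. Reals can be compared, but there is no rounding operation leading
  from reals back to words, and the only real literals are natural numbers.
\<close>

datatype wexp =
    Lit nat
  | WCell wexp
  | WAdd wexp wexp
  | WSub wexp wexp
  | WMul wexp wexp
  | WDiv wexp wexp
  | WMod wexp wexp

datatype rexp =
    OfWord wexp
  | RCell wexp
  | RAdd rexp rexp
  | RSub rexp rexp
  | RMul rexp rexp
  | RDiv rexp rexp

datatype test =
    WLess wexp wexp
  | RLess rexp rexp

datatype prog =
    Skip
  | WSet wexp wexp  \<comment> \<open>address, new value\<close>
  | RSet wexp rexp  \<comment> \<open>address, new value\<close>
  | Out wexp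
  | Seq prog prog
  | Cond test prog prog
  | Loop test prog

record store =
  words :: "nat \<Rightarrow> nat"
  reals :: "nat \<Rightarrow> real"
  outp :: "nat list"

primrec wval :: "wexp \<Rightarrow> store \<Rightarrow> nat" where
  "wval (Lit k) s = k"
| "wval (WCell a) s = words s (wval a s)"
| "wval (WAdd a b) s = wval a s + wval b s"
| "wval (WSub a b) s = wval a s - wval b s"
| "wval (WMul a b) s = wval a s * wval b s"
| "wval (WDiv a b) s = wval a s div wval b s"
| "wval (WMod a b) s = wval a s mod wval b s"

primrec rval :: "rexp \<Rightarrow> store \<Rightarrow> real" where
  "rval (OfWord a) s = real (wval a s)"
| "rval (RCell a) s = reals s (wval a s)"
| "rval (RAdd a b) s = rval a s + rval b s"
| "rval (RSub a b) s = rval a s - rval b s"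
| "rval (RMul a b) s = rval a s * rval b s"
| "rval (RDiv a b) s = rval a s / rval b s"

primrec tval :: "test \<Rightarrow> store \<Rightarrow> bool" where
  "tval (WLess a b) s = (wval a s < wval b s)"
| "tval (RLess a b) s = (rval a s < rval b s)"

text \<open>
  \<open>exec W P s t s'\<close>: started in \<open>s\<close>, program \<open>P\<close> halts in \<open>s'\<close> after \<open>t\<close> steps. Every
  assignment, output and test costs one step; since the expressions occurring in a program have
  constant size, this agrees with counting single operations up to a factor depending only on
  the program. All addresses written to and all words stored or output must be below \<open>W\<close>; a
  program that violates this has no execution. Hence unit cost arithmetic cannot be abused by
  building up long numbers.
\<close>

inductive exec :: "nat \<Rightarrow> prog \<Rightarrow> store \<Rightarrow> nat \<Rightarrow> store \<Rightarrow> bool" for W :: nat where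
  exec_Skip: "exec W Skip s 0 s"
| exec_WSet: "wval a s < W \<Longrightarrow> wval e s < W \<Longrightarrow>
    exec W (WSet a e) s 1 (s\<lparr>words := (words s)(wval a s := wval e s)\<rparr>)"
| exec_RSet: "wval a s < W \<Longrightarrow>
    exec W (RSet a e) s 1 (s\<lparr>reals := (reals s)(wval a s := rval e s)\<rparr>)"
| exec_Out: "wval e s < W \<Longrightarrow> exec W (Out e) s 1 (s\<lparr>outp := outp s @ [wval e s]\<rparr>)"
| exec_Seq: "exec W P s t s' \<Longrightarrow> exec W Q s' u s'' \<Longrightarrow> exec W (Seq P Q) s (t + u) s''"
| exec_CondT: "tval b s \<Longrightarrow> exec W P s t s' \<Longrightarrow> exec W (Cond b P Q) s (Suc t) s'"
| exec_CondF: "\<not> tval b s \<Longrightarrow> exec W Q s t s' \<Longrightarrow> exec W (Cond b P Q) s (Suc t) s'"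
| exec_LoopF: "\<not> tval b s \<Longrightarrow> exec W (Loop b P) s 1 s"
| exec_LoopT: "tval b s \<Longrightarrow> exec W P s t s' \<Longrightarrow> exec W (Loop b P) s' u s'' \<Longrightarrow>
    exec W (Loop b P) s (Suc (t + u)) s''"

inductive_cases exec_SkipE: "exec W Skip s t s'"
inductive_cases exec_WSetE: "exec W (WSet a e) s t s'"
inductive_cases exec_RSetE: "exec W (RSet a e) s t s'"
inductive_cases exec_OutE: "exec W (Out e) s t s'"
inductive_cases exec_SeqE: "exec W (Seq P Q) s t s'"
inductive_cases exec_CondE: "exec W (Cond b P Q) s t s'"
inductive_cases exec_LoopE: "exec W (Loop b P) s t s'"

lemma exec_deterministic:
  "exec W P s t s1 \<Longrightarrow> exec W P s u s2 \<Longrightarrow> t = u \<and> s1 = s2"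
proof (induction arbitrary: u s2 rule: exec.induct)
  case (exec_Skip s)
  show ?case
    using exec_Skip.prems by (rule exec_SkipE) simp
next
  case (exec_WSet a s e)
  show ?case
    using exec_WSet.prems by (rule exec_WSetE) simp
next
  case (exec_RSet a s e)
  show ?case
    using exec_RSet.prems by (rule exec_RSetE) simp
next
  case (exec_Out e s)
  show ?case
    using exec_Out.prems by (rule exec_OutE) simp
next
  case (exec_Seq P s t s' Q v s'')
  show ?case
    using exec_Seq.prems by (rule exec_SeqE) (use exec_Seq.IH in blast)+
next
  case (exec_CondT b s P t s' Q)
  show ?case
    using exec_CondT.prems by (rule exec_CondE) (use exec_CondT.IH exec_CondT.hyps in blast)+
next
  case (exec_CondF b s Q t s' P)
  show ?case
    using exec_CondF.prems by (rule exec_CondE) (use exec_CondF.IH exec_CondF.hyps in blast)+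
next
  case (exec_LoopF b s P)
  show ?case
    using exec_LoopF.prems by (rule exec_LoopE) (use exec_LoopF.hyps in auto)+
next
  case (exec_LoopT b s P t s' v s'')
  show ?case
    using exec_LoopT.prems by (rule exec_LoopE) (use exec_LoopT.IH exec_LoopT.hyps in blast)+
qed

section \<open>Construction in linear time\<close>

definition input_store :: "nat \<Rightarrow> nat \<Rightarrow> nat \<Rightarrow> real \<Rightarrow> store" where
  "input_store n q d \<epsilon> =
     \<lparr>words = (\<lambda>_. 0)(0 := n, 1 := q, 2 := d), reals = (\<lambda>_. 0)(0 := \<epsilon>), outp = []\<rparr>"

definition family_table :: "nat \<Rightarrow> (nat \<Rightarrow> nat) list \<Rightarrow> nat list" where
  "family_table n H = concat (map (\<lambda>h. map h [0..<n]) H)"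

text \<open>
  On input \<open>(n, q, d, \<epsilon>)\<close>, the program \<open>P\<close> prints the value tables of the members of \<open>H\<close> within
  \<open>c * (length H * n)\<close> steps. The bound on the words amounts to words of
  \<open>O(log (n + q + length H))\<close> bits.
\<close>

definition constructs_in_linear_time ::
  "nat \<Rightarrow> prog \<Rightarrow> nat \<Rightarrow> nat \<Rightarrow> nat \<Rightarrow> real \<Rightarrow> (nat \<Rightarrow> nat) list \<Rightarrow> bool" where
  "constructs_in_linear_time c P n q d \<epsilon> H \<longleftrightarrow>
     (\<exists>t s. exec ((n + q + length H) ^ c) P (input_store n q d \<epsilon>) t s \<and>
            outp s = family_table n H \<and> t \<le> c * (length H * n))"

section \<open>The bounds\<close>

definition pairs_plus_one :: "nat \<Rightarrow> real" where
  "pairs_plus_one d = real d * (real d - 1) / 2 + 1"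

text \<open>
  The bounds drop below 1 for instance if \<open>n = 1\<close> or if \<open>q\<close> is huge compared to \<open>n\<close>, whereas a
  nonempty family has size at least 1. So a size \<open>O(f)\<close> is to be stated as
  \<open>length H \<le> C * max 1 f\<close>, which is \<open>length H \<le> C * f\<close> as soon as \<open>f \<ge> 1\<close>, in particular for all
  sufficiently large \<open>n\<close> when the other parameters are fixed.
\<close>

definition size_large_eps :: "nat \<Rightarrow> nat \<Rightarrow> nat \<Rightarrow> real \<Rightarrow> real" where
  "size_large_eps n q d \<epsilon> =
     real d ^ 2 * ln (real n) / (\<epsilon> * ln (\<epsilon> * real q / (exp 1 * pairs_plus_one d)))"

definition size_small_eps :: "nat \<Rightarrow> nat \<Rightarrow> nat \<Rightarrow> real \<Rightarrow> real" where
  "size_small_eps n q d \<epsilon> =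
     real q ^ 2 * real d ^ 2 * ln (real n) / (\<epsilon> * (real q - pairs_plus_one d / \<epsilon>) ^ 2)"

end

theory Submission
  imports Defs "HOL-Number_Theory.Cong"
begin

text \<open>
  It suffices to find functions \<open>[n] \<rightarrow> [q]\<close> such that any two points collide under a fraction of
  at most \<open>\<delta> = \<epsilon> / (d (d - 1) / 2 + 1)\<close> of them. If \<open>n \<le> q\<close> the identity serves, and if
  \<open>\<epsilon> \<ge> 1\<close> any function does. Otherwise let \<open>q = p\<^sup>r\<close> and take functions that are linear over the
  field with \<open>p\<close> elements in the base \<open>p\<close> digits and the identity on \<open>[q]\<close>; then only the pairs
  \<open>(b, u)\<close> with \<open>u < b = p\<^sup>k < n\<close> and \<open>b \<ge> q\<close> need to be watched, and the powers \<open>b\<close> sum up to less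
  than \<open>2 n\<close>. The functions are found by the method of conditional expectations: with weight
  \<open>x\<close> to the number of past collisions of \<open>(b, u)\<close>, where \<open>x = \<delta> q\<close>, the value at \<open>b\<close> is chosen
  such that the pairs \<open>(b, u)\<close> that collide have at most the average weight. Thus each function
  multiplies the total weight by at most \<open>1 + (x - 1) / q\<close>, whereas a pair with too many collisions
  after \<open>t\<close> functions has weight more than \<open>x\<close> to the power \<open>\<delta> t\<close>. Hence the collisions are
  balanced for some \<open>t\<close> of order \<open>log n / (\<delta> (ln x - 1 + 1 / x))\<close>, and the program prints functions
  until it observes this. Both parts of the theorem are estimates of \<open>ln x - 1 + 1 / x\<close>.
\<close>

section \<open>Digitwise linear functions\<close>

definition digit :: "nat \<Rightarrow> nat \<Rightarrow> nat \<Rightarrow> nat" where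
  "digit p i x = x div p ^ i mod p"

text \<open>For \<open>e = p ^ k\<close> this adds 1 modulo \<open>p\<close> to the digit at
  position \<open>k\<close> and carries nothing upwards. On numbers below \<open>p ^ r\<close> with
  \<open>k < r\<close>, read as vectors of \<open>r\<close> digits over the field with
  \<open>p\<close> elements, it is the addition of a unit vector. The form uses only arithmetic that
  the machine offers.\<close>

definition incr_digit :: "nat \<Rightarrow> nat \<Rightarrow> nat \<Rightarrow> nat" where
  "incr_digit p e y = y div (e * p) * (e * p) + (y div e + 1) mod p * e + y mod e"

lemma digit_0 [simp]: "digit p i 0 = 0"
  by (simp add: digit_def)

lemma digit_less: "p > 0 \<Longrightarrow> digit p i x < p"
  by (simp add: digit_def)

lemma digit_eq_0: "x < p ^ i \<Longrightarrow> digit p i x = 0"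
  by (simp add: digit_def)

lemma digit_Suc: "digit p (Suc i) x = digit p i (x div p)"
  by (simp add: digit_def div_mult2_eq)

lemma digit_ext:
  assumes "p \<ge> 2" "\<And>j. digit p j x = digit p j y"
  shows "x = y"
  using assms(2)
proof (induction "x + y" arbitrary: x y rule: less_induct)
  case less
  show ?case
  proof (cases "x + y = 0")
    case False
    have mod: "x mod p = y mod p"
      using less.prems[of 0] by (simp add: digit_def)
    have "x div p + y div p < x + y"
    proof (cases "x = 0")
      case True
      then show ?thesis using False assms(1) by simp
    next
      case xpos: False
      have "x div p < x" using xpos assms(1) by simp
      moreover have "y div p \<le> y" by simp
      ultimately show ?thesis by linarith
    qed
    moreover have "digit p j (x div p) = digit p j (y div p)" for j
      using less.prems[of "Suc j"] by (simp add: digit_Suc)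
    ultimately have "x div p = y div p"
      using less.hyps by blast
    with mod show ?thesis
      by (metis div_mult_mod_eq)
  qed simp
qed

lemma digit_power:
  assumes "p \<ge> 2"
  shows "digit p j (p ^ k) = (if j = k then 1 else 0)"
proof (cases j k rule: linorder_cases)
  case less
  then obtain m where "k = j + Suc m"
    using less_imp_Suc_add by fastforce
  then show ?thesis using assms by (simp add: digit_def power_add)
qed (use assms in \<open>auto simp: digit_def\<close>)

text \<open>The quotients by \<open>e * p\<close> and \<open>e\<close> and the remainder by
  \<open>e\<close> give access to the digits above, at and below the incremented position.\<close>

lemma incr_digit_div:
  assumes "p > 0" "e > 0"
  shows "incr_digit p e y div (e * p) = y div (e * p)"
    and "incr_digit p e y div e = y div (e * p) * p + (y div e + 1) mod p"
    and "incr_digit p e y mod e = y mod e"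
proof -
  let ?c = "(y div e + 1) mod p"
  have *: "incr_digit p e y = (y div (e * p) * p + ?c) * e + y mod e"
    by (simp add: incr_digit_def algebra_simps)
  show d: "incr_digit p e y div e = y div (e * p) * p + ?c"
    unfolding * using assms by simp
  show "incr_digit p e y mod e = y mod e"
    unfolding * using assms by simp
  show "incr_digit p e y div (e * p) = y div (e * p)"
    unfolding div_mult2_eq[of "incr_digit p e y"] d using assms by simp
qed

lemma digit_incr_digit:
  assumes "p \<ge> 2"
  shows "digit p j (incr_digit p (p ^ k) y) = (digit p j y + (if j = k then 1 else 0)) mod p"
proof -
  have pos: "p > 0" "p ^ k > 0" using assms by auto
  note div = incr_digit_div[OF pos]
  show ?thesis
  proof (cases j k rule: linorder_cases)
    case less
    then obtain m where k: "k = j + Suc m"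
      using less_imp_Suc_add by fastforce
    \<comment> \<open>A digit below position \<open>k\<close> depends only on the residue modulo
      \<open>p ^ k\<close>, which the increment preserves.\<close>
    have red: "z mod p ^ k div p ^ j mod p = z div p ^ j mod p" for z
    proof -
      have "z mod p ^ k = p ^ j * (z div p ^ j mod p ^ Suc m) + z mod p ^ j"
        unfolding k power_add by (rule mod_mult2_eq)
      then have "z mod p ^ k div p ^ j = z div p ^ j mod p ^ Suc m"
        using pos by simp
      then show ?thesis
        by (simp add: mod_mod_cancel)
    qed
    show ?thesis
      using less red[of y] red[of "incr_digit p (p ^ k) y"] div(3)[of y]
      by (simp add: digit_def)
  next
    case equal
    then show ?thesis
      using div(2)[of y] by (simp add: digit_def mod_Suc_eq)
  next
    case greater
    then obtain m where j: "j = Suc k + m"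
      using less_imp_Suc_add by fastforce
    have "z div p ^ j = z div (p ^ k * p) div p ^ m" for z
      unfolding j power_add power_Suc2 by (rule div_mult2_eq)
    then show ?thesis
      using greater div(1)[of y] by (simp add: digit_def)
  qed
qed

lemma incr_digit_less:
  assumes "p \<ge> 2" "y < p ^ r" "k < r"
  shows "incr_digit p (p ^ k) y < p ^ r"
proof -
  have pos: "p > 0" "p ^ k > 0" using assms by auto
  obtain m where r: "r = Suc k + m"
    using assms(3) less_imp_Suc_add by fastforce
  have "z div p ^ r = z div (p ^ k * p) div p ^ m" for z
    unfolding r power_add power_Suc2 by (rule div_mult2_eq)
  then have "incr_digit p (p ^ k) y div p ^ r = y div p ^ r"
    by (simp add: incr_digit_div(1)[OF pos])
  then show ?thesis
    using assms(2) pos by (simp add: div_eq_0_iff)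
qed

text \<open>The leading digit of \<open>v\<close> is nonzero, so subtracting \<open>p ^ k\<close>
  borrows nothing, and incrementing the digit at \<open>k\<close> gives \<open>v\<close>
  back.\<close>

lemma digit_split_top:
  assumes "p \<ge> 2" "p ^ k \<le> v" "v < p ^ Suc k"
  shows "digit p j v = (digit p j (v - p ^ k) + digit p j (p ^ k)) mod p"
proof -
  have pos: "p > 0" "p ^ k > 0" using assms by auto
  have "(v - p ^ k) div p ^ k + 1 = v div p ^ k"
    using assms(2) pos by (simp add: le_div_geq)
  moreover have "v div p ^ k < p"
    using assms(3) pos by (simp add: less_mult_imp_div_less)
  moreover have "(v - p ^ k) div (p ^ k * p) = 0"
    using assms(3) by (simp add: mult.commute)
  moreover have "(v - p ^ k) mod p ^ k = v mod p ^ k"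
    using assms(2) by (simp add: le_mod_geq)
  ultimately have "incr_digit p (p ^ k) (v - p ^ k) = v"
    unfolding incr_digit_def by (simp add: div_mult_mod_eq)
  then show ?thesis
    using digit_incr_digit[OF assms(1), of j k "v - p ^ k"] assms(1) by (simp add: digit_power)
qed

lemma top_power_exists:
  assumes "p \<ge> 2" "x > 0"
  obtains k where "p ^ k \<le> (x::nat)" "x < p ^ Suc k"
  using ex_power_ivl1[of p x] assms by auto

lemma exists_digits:
  assumes "p \<ge> 2" "\<And>i. i < k \<Longrightarrow> c i < p"
  shows "\<exists>u<p ^ k. \<forall>i<k. digit p i u = c i"
  using assms(2)
proof (induction k)
  case (Suc k)
  then obtain u where u: "u < p ^ k" "\<forall>i<k. digit p i u = c i"
    by auto
  let ?v = "u + c k * p ^ k"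
  have "?v < p ^ k + c k * p ^ k" using u(1) by simp
  also have "\<dots> = Suc (c k) * p ^ k" by simp
  also have "\<dots> \<le> p * p ^ k" using Suc.prems[of k] by (intro mult_right_mono) auto
  finally have less: "?v < p ^ Suc k" by simp
  have "digit p i ?v = c i" if "i < Suc k" for i
  proof (cases "i = k")
    case True
    then show ?thesis
      using u(1) Suc.prems[of k] assms(1) by (simp add: digit_def)
  next
    case False
    with that have "i < k" by simp
    then obtain m where k: "k = i + Suc m"
      using less_imp_Suc_add by fastforce
    have "?v = u + (c k * p ^ m * p) * p ^ i"
      by (simp add: k power_add algebra_simps)
    also have "\<dots> div p ^ i = c k * p ^ m * p + u div p ^ i"
      using assms(1) by (subst div_mult_self1) auto
    finally have "digit p i ?v = digit p i u"
      by (simp add: digit_def)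
    with u(2) \<open>i < k\<close> show ?thesis by simp
  qed
  with less show ?case by blast
qed auto

section \<open>Functions that are linear in the digits\<close>

definition digit_additive :: "nat \<Rightarrow> nat \<Rightarrow> (nat \<Rightarrow> nat) \<Rightarrow> bool" where
  "digit_additive p n h \<longleftrightarrow> h 0 = 0 \<and>
     (\<forall>k x j. p ^ k \<le> x \<longrightarrow> x < p ^ Suc k \<longrightarrow> x < n \<longrightarrow>
        digit p j (h x) = (digit p j (h (x - p ^ k)) + digit p j (h (p ^ k))) mod p)"

lemma digit_additive_cong:
  assumes "\<And>x. x < n \<Longrightarrow> h x = h' x" "n > 0" "digit_additive p n h"
  shows "digit_additive p n h'"
  unfolding digit_additive_def
proof (intro conjI allI impI)
  show "h' 0 = 0"
    using assms by (simp add: digit_additive_def)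
next
  fix k x j assume "p ^ k \<le> x" "x < p ^ Suc k" "x < n"
  moreover from this have "h x = h' x" "h (x - p ^ k) = h' (x - p ^ k)" "h (p ^ k) = h' (p ^ k)"
    by (auto intro!: assms(1))
  ultimately show "digit p j (h' x) = (digit p j (h' (x - p ^ k)) + digit p j (h' (p ^ k))) mod p"
    using assms(3) unfolding digit_additive_def by metis
qed

text \<open>\<open>digit_additive\<close> only requires that the leading power can be split off,
  which is how a table is filled in increasing order. Splitting repeatedly yields full linearity.
  Since \<open>k < p ^ k <= x < n\<close> for the leading position \<open>k\<close>, summing over
  the positions below some \<open>K >= n\<close> avoids logarithms.\<close>

lemma digit_additive_sum:
  assumes "p \<ge> 2" "digit_additive p n h" "x < n" "n \<le> K"
  shows "[digit p j (h x) = (\<Sum>i<K. digit p i x * digit p j (h (p ^ i)))] (mod p)"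
  using assms(3)
proof (induction x rule: less_induct)
  case (less x)
  show ?case
  proof (cases "x = 0")
    case True
    then show ?thesis using assms(2) by (simp add: digit_additive_def)
  next
    case False
    then obtain k where k: "p ^ k \<le> x" "x < p ^ Suc k"
      using top_power_exists assms(1) by blast
    have "k < p ^ k" using assms(1) by (intro power_gt_expt) auto
    then have kK: "k < K" using k less.prems assms(4) by linarith
    let ?y = "x - p ^ k" and ?A = "\<lambda>i. digit p j (h (p ^ i))"
    have "?y < x" using k False assms(1) by auto
    then have IH: "[digit p j (h ?y) = (\<Sum>i<K. digit p i ?y * ?A i)] (mod p)"
      using less by auto
    have "[digit p j (h x) = digit p j (h ?y) + ?A k] (mod p)"
      using assms(2) k less.prems by (simp add: digit_additive_def cong_def)
    also have "[digit p j (h ?y) + ?A k = (\<Sum>i<K. digit p i ?y * ?A i) + ?A k] (mod p)"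
      by (intro cong_add IH cong_refl)
    also have "(\<Sum>i<K. digit p i ?y * ?A i) + ?A k
        = (\<Sum>i<K. digit p i ?y * ?A i) + (\<Sum>i<K. if i = k then ?A i else 0)"
      using kK by (simp add: sum.delta)
    also have "\<dots> = (\<Sum>i<K. (digit p i ?y + digit p i (p ^ k)) * ?A i)"
      by (subst sum.distrib[symmetric], intro sum.cong refl)
        (auto simp: digit_power[OF assms(1)] algebra_simps)
    also have "[\<dots> = (\<Sum>i<K. digit p i x * ?A i)] (mod p)"
      by (intro cong_sum cong_mult cong_refl)
        (simp add: digit_split_top[OF assms(1) k] cong_def)
    finally show ?thesis .
  qed
qed

text \<open>
  Scaling by the inverse of the leading coefficient turns the difference of \<open>x\<close> and \<open>y\<close> into
  the difference of a power of \<open>p\<close> and a smaller number, independently of \<open>h\<close>.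
\<close>

lemma digit_additive_collision:
  assumes p: "prime p" and xy: "x \<noteq> y" "x < n" "y < n"
  obtains k u where "p ^ k < n" "u < p ^ k"
    "\<And>h. digit_additive p n h \<Longrightarrow> h x = h y \<Longrightarrow> h (p ^ k) = h u"
proof -
  have p2: "p \<ge> 2" using p by (rule prime_ge_2_nat)
  let ?D = "{i. digit p i x \<noteq> digit p i y}"
  have below: "p ^ i < n" if "i \<in> ?D" for i
  proof (rule ccontr)
    assume "\<not> p ^ i < n"
    then have "digit p i x = 0" "digit p i y = 0"
      using xy by (auto intro!: digit_eq_0)
    with that show False by simp
  qed
  have "?D \<subseteq> {..<n}"
  proof
    fix i assume "i \<in> ?D"
    moreover have "i < p ^ i" using p2 by (intro power_gt_expt) auto
    ultimately show "i \<in> {..<n}" using below[of i] by auto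
  qed
  then have fin: "finite ?D" by (rule finite_subset) simp
  have ne: "?D \<noteq> {}" using digit_ext[OF p2, of x y] xy(1) by auto
  \<comment> \<open>The leading position at which \<open>x\<close> and \<open>y\<close> differ;
    above it their digits cancel.\<close>
  define k where "k = Max ?D"
  have kD: "k \<in> ?D" unfolding k_def by (rule Max_in[OF fin ne])
  have above: "digit p i x = digit p i y" if "i > k" for i
    using Max_ge[OF fin, of i] that by (auto simp: k_def)
  define \<delta> where "\<delta> i = int (digit p i x) - int (digit p i y)" for i
  have "\<not> int p dvd \<delta> k"
  proof
    assume "int p dvd \<delta> k"
    then have "int (digit p k x) mod int p = int (digit p k y) mod int p"
      unfolding \<delta>_def by (simp add: mod_eq_dvd_iff)
    then have "digit p k x = digit p k y"
      using digit_less[of p] p2 by (simp flip: zmod_int)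
    with kD show False by simp
  qed
  then have "coprime (\<delta> k) (int p)"
    using p by (metis coprime_commute prime_imp_coprime prime_int_nat_transfer prime_nat_int_transfer)
  then obtain s where s: "[\<delta> k * s = 1] (mod int p)"
    using cong_solve_coprime_int by blast
  \<comment> \<open>With \<open>s\<close> inverse to \<open>\<delta> k\<close>, these digits of
    \<open>u\<close> make the digits of \<open>p ^ k\<close> minus those of \<open>u\<close>
    congruent to \<open>s * \<delta> i\<close> at every position. The sign appears because
    \<open>u\<close> is subtracted.\<close>
  define c where "c i = nat (- s * \<delta> i mod int p)" for i
  have "c i < p" for i
    using p2 by (simp add: c_def nat_less_iff)
  then obtain u where u: "u < p ^ k" "\<forall>i<k. digit p i u = c i"
    using exists_digits[OF p2, of k c] by auto
  have "h (p ^ k) = h u" if h: "digit_additive p n h" "h x = h y" for h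
  proof (rule digit_ext[OF p2])
    fix j
    let ?A = "\<lambda>i. int (digit p j (h (p ^ i)))"
    have kn: "k < n"
      using \<open>?D \<subseteq> {..<n}\<close> kD by blast
    have lin: "[int (digit p j (h z)) = (\<Sum>i<n. int (digit p i z) * ?A i)] (mod int p)"
      if "z < n" for z
      using digit_additive_sum[OF p2 h(1) that order_refl, of j]
      by (simp flip: cong_int_iff)
    have upto_k: "(\<Sum>i<n. f i) = (\<Sum>i<k. f i) + f k" if "\<And>i. i > k \<Longrightarrow> f i = 0"
      for f :: "nat \<Rightarrow> int"
    proof -
      have "(\<Sum>i<n. f i) = (\<Sum>i<Suc k. f i)"
        using kn that by (intro sum.mono_neutral_right) auto
      then show ?thesis by simp
    qed
    have "[(\<Sum>i<n. int (digit p i x) * ?A i) = (\<Sum>i<n. int (digit p i y) * ?A i)] (mod int p)"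
      using cong_trans[OF cong_sym[OF lin[OF xy(2)]]] lin[OF xy(3)] h(2) by simp
    then have "[(\<Sum>i<n. \<delta> i * ?A i) = 0] (mod int p)"
      by (simp add: \<delta>_def left_diff_distrib sum_subtractf cong_diff_iff_cong_0)
    moreover have "(\<Sum>i<n. \<delta> i * ?A i) = (\<Sum>i<k. \<delta> i * ?A i) + \<delta> k * ?A k"
      by (rule upto_k) (simp add: \<delta>_def above)
    ultimately have "[s * ((\<Sum>i<k. \<delta> i * ?A i) + \<delta> k * ?A k) = s * 0] (mod int p)"
      by (intro cong_mult cong_refl) simp
    then have 1: "[s * (\<Sum>i<k. \<delta> i * ?A i) + (\<delta> k * s) * ?A k = 0] (mod int p)"
      by (simp add: algebra_simps)
    have "[s * (\<Sum>i<k. \<delta> i * ?A i) + (\<delta> k * s) * ?A k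
        = s * (\<Sum>i<k. \<delta> i * ?A i) + 1 * ?A k] (mod int p)"
      by (intro cong_add cong_mult cong_refl s)
    from cong_trans[OF cong_sym[OF this] 1]
    have "[s * (\<Sum>i<k. \<delta> i * ?A i) + ?A k = 0] (mod int p)"
      by simp
    then have 2: "[?A k = - s * (\<Sum>i<k. \<delta> i * ?A i)] (mod int p)"
      by (simp add: cong_iff_dvd_diff add.commute)
    have "u < n" using u(1) below[OF kD] by simp
    have "(\<Sum>i<n. int (digit p i u) * ?A i)
        = (\<Sum>i<k. int (digit p i u) * ?A i) + int (digit p k u) * ?A k"
    proof (rule upto_k)
      fix i assume "i > k"
      then have "p ^ k \<le> p ^ i" using p2 by (intro power_increasing) auto
      then show "int (digit p i u) * ?A i = 0" using u(1) by (simp add: digit_eq_0)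
    qed
    also have "\<dots> = (\<Sum>i<k. int (c i) * ?A i)"
      using u by (simp add: digit_eq_0)
    also have "[\<dots> = (\<Sum>i<k. (- s * \<delta> i) * ?A i)] (mod int p)"
      using p2 by (intro cong_sum cong_mult cong_refl) (simp add: c_def cong_def)
    also have "(\<Sum>i<k. (- s * \<delta> i) * ?A i) = - s * (\<Sum>i<k. \<delta> i * ?A i)"
      by (simp add: sum_distrib_left algebra_simps)
    finally have "[(\<Sum>i<n. int (digit p i u) * ?A i) = ?A k] (mod int p)"
      using 2 cong_sym cong_trans by blast
    from cong_trans[OF lin[OF \<open>u < n\<close>] this]
    have "[int (digit p j (h u)) = ?A k] (mod int p)" .
    then have "[digit p j (h u) = digit p j (h (p ^ k))] (mod p)"
      by (simp add: cong_int_iff)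
    then show "digit p j (h (p ^ k)) = digit p j (h u)"
      using digit_less[of p j] p2 by (simp add: cong_def)
  qed
  with that below[OF kD] u(1) show ?thesis by blast
qed

section \<open>Collisions and density\<close>

definition collisions :: "(nat \<Rightarrow> nat) list \<Rightarrow> nat \<Rightarrow> nat \<Rightarrow> nat" where
  "collisions H x y = length (filter (\<lambda>h. h x = h y) H)"

lemma collisions_Nil [simp]: "collisions [] x y = 0"
  by (simp add: collisions_def)

lemma collisions_snoc [simp]:
  "collisions (H @ [h]) x y = collisions H x y + (if h x = h y then 1 else 0)"
  by (simp add: collisions_def)

lemma collisions_le: "collisions H x y \<le> length H"
  by (simp add: collisions_def)

lemma collisions_mono:
  assumes "\<And>h. h \<in> set H \<Longrightarrow> h x = h y \<Longrightarrow> h x' = h y'"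
  shows "collisions H x y \<le> collisions H x' y'"
  using assms by (induction H) (auto simp: collisions_def)

text \<open>Each function that is not injective on \<open>S\<close> has a colliding pair, so it is
  counted at least once on the right.\<close>

lemma not_inj_le_sum_collisions:
  assumes "finite S"
  shows "length (filter (\<lambda>h. \<not> inj_on h S) H)
    \<le> (\<Sum>(x, y)\<in>{(x, y). x \<in> S \<and> y \<in> S \<and> x < y}. collisions H x y)"
proof (induction H)
  case (Cons h H)
  let ?E = "{(x::nat, y). x \<in> S \<and> y \<in> S \<and> x < y}"
  have fin: "finite ?E"
    by (rule finite_subset[of _ "S \<times> S"]) (use assms in auto)
  have "(if inj_on h S then 0 else 1) \<le> (\<Sum>(x, y)\<in>?E. if h x = h y then 1 else 0 :: nat)"
  proof (cases "inj_on h S")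
    case False
    then obtain x y where "x \<in> S" "y \<in> S" "h x = h y" "x < y"
      unfolding inj_on_def by (metis linorder_neqE_nat)
    then have "(x, y) \<in> ?E" "(case (x, y) of (x, y) \<Rightarrow> if h x = h y then 1 else 0) = (1::nat)"
      by auto
    with False show ?thesis
      using member_le_sum[OF \<open>(x, y) \<in> ?E\<close> _ fin, of "\<lambda>(x, y). if h x = h y then 1 else 0 :: nat"]
      by auto
  qed simp
  moreover have "(\<Sum>(x, y)\<in>?E. collisions (h # H) x y)
      = (\<Sum>(x, y)\<in>?E. if h x = h y then 1 else 0) + (\<Sum>(x, y)\<in>?E. collisions H x y)"
    by (subst sum.distrib[symmetric]) (auto simp: collisions_def intro!: sum.cong)
  ultimately show ?case
    using Cons.IH by (auto split: if_splits)
qed simp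

text \<open>The square of \<open>S\<close> is the disjoint union of the diagonal, the increasing
  pairs and their mirror images.\<close>

lemma card_increasing_pairs:
  assumes "finite (S :: nat set)"
  shows "2 * card {(x, y). x \<in> S \<and> y \<in> S \<and> x < y} = card S * (card S - 1)"
proof -
  let ?E = "{(x, y). x \<in> S \<and> y \<in> S \<and> x < y}"
  have fin: "finite ?E" "finite (prod.swap ` ?E)"
    by (rule finite_subset[of _ "S \<times> S"]; use assms in auto)+
  have "S \<times> S = (\<lambda>x. (x, x)) ` S \<union> (?E \<union> prod.swap ` ?E)"
    by (auto simp: image_iff)
  then have "card (S \<times> S) = card ((\<lambda>x. (x, x)) ` S \<union> (?E \<union> prod.swap ` ?E))"
    by (rule arg_cong)
  also have "\<dots> = card ((\<lambda>x. (x, x)) ` S) + (card ?E + card (prod.swap ` ?E))"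
    using fin assms by (subst card_Un_disjoint; (subst card_Un_disjoint)?; auto)
  also have "card ((\<lambda>x. (x, x)) ` S) = card S"
    by (rule card_image) (auto simp: inj_on_def)
  also have "card (prod.swap ` ?E) = card ?E"
    by (rule card_image) (auto simp: inj_on_def)
  finally have "card S * card S = card S + 2 * card ?E"
    by (simp add: card_cartesian_product)
  then show ?thesis
    by (cases "card S") auto
qed

text \<open>This is a union bound: \<open>S\<close> has \<open>pairs_plus_one d - 1\<close> pairs,
  each spoiled by at most the fraction \<open>\<epsilon> / pairs_plus_one d\<close> of the
  functions.\<close>

lemma dense_phf_of_collisions:
  assumes "H \<noteq> []" "\<And>h. h \<in> set H \<Longrightarrow> h \<in> {..<n} \<rightarrow> {..<q}" "\<epsilon> > 0"
    and coll: "\<And>x y. x < n \<Longrightarrow> y < n \<Longrightarrow> x \<noteq> y \<Longrightarrow>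
      real (collisions H x y) * pairs_plus_one d \<le> \<epsilon> * real (length H)"
  shows "dense_phf (1 - \<epsilon>) n q d H"
  unfolding dense_phf_def
proof (intro conjI ballI allI impI)
  fix S assume S: "S \<subseteq> {..<n}" "card S = d"
  let ?E = "{(x, y). x \<in> S \<and> y \<in> S \<and> x < y}"
  have fin: "finite S" using S(1) by (rule finite_subset) simp
  have "real (2 * card ?E) = real (d * (d - 1))"
    using card_increasing_pairs[OF fin] S(2) by simp
  then have card: "real (card ?E) = pairs_plus_one d - 1"
    by (cases d) (auto simp: pairs_plus_one_def algebra_simps)
  then have P: "pairs_plus_one d \<ge> 1"
    using of_nat_0_le_iff[of "card ?E", where 'a = real] by linarith
  have "real (length (filter (\<lambda>h. \<not> inj_on h S) H))
      \<le> (\<Sum>e\<in>?E. real (case e of (x, y) \<Rightarrow> collisions H x y))"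
    using not_inj_le_sum_collisions[OF fin, of H] by (simp flip: of_nat_sum)
  also have "\<dots> \<le> real (card ?E) * (\<epsilon> * real (length H) / pairs_plus_one d)"
  proof (rule sum_bounded_above)
    fix e assume "e \<in> ?E"
    then obtain x y where "e = (x, y)" "x \<in> S" "y \<in> S" "x < y" by auto
    then show "real (case e of (x, y) \<Rightarrow> collisions H x y) \<le> \<epsilon> * real (length H) / pairs_plus_one d"
      using coll[of x y] S(1) P by (auto simp: field_simps)
  qed
  also have "\<dots> = \<epsilon> * real (length H) * ((pairs_plus_one d - 1) / pairs_plus_one d)"
    by (simp add: card)
  also have "\<dots> \<le> \<epsilon> * real (length H) * 1"
    using P assms(3) by (intro mult_left_mono) auto
  finally have "real (length (filter (\<lambda>h. \<not> inj_on h S) H)) \<le> \<epsilon> * real (length H)"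
    by simp
  moreover have "real (length H)
      = real (length (filter (\<lambda>h. inj_on h S) H)) + real (length (filter (\<lambda>h. \<not> inj_on h S) H))"
    using sum_length_filter_compl[of "\<lambda>h. inj_on h S" H] by linarith
  ultimately show "(1 - \<epsilon>) * real (length H) \<le> real (length (filter (\<lambda>h. inj_on h S) H))"
    by (simp add: left_diff_distrib)
qed (use assms(1,2) in auto)

section \<open>The potential argument\<close>

text \<open>These are the powers at which a hash function is free: below \<open>q\<close> it is the
  identity, and its value at a power \<open>b\<close> of \<open>p\<close> together with the values
  below \<open>b\<close> determines, by additivity, the values up to \<open>b * p\<close>.\<close>

definition levels :: "nat \<Rightarrow> nat \<Rightarrow> nat \<Rightarrow> nat set" where
  "levels p q n = {b. (\<exists>k. b = p ^ k) \<and> q \<le> b \<and> b < n}"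

definition hash_function :: "nat \<Rightarrow> nat \<Rightarrow> nat \<Rightarrow> (nat \<Rightarrow> nat) \<Rightarrow> bool" where
  "hash_function p q n h \<longleftrightarrow> (\<forall>x<n. h x < q) \<and> (\<forall>x<q. h x = x) \<and> digit_additive p n h"

definition balanced :: "nat \<Rightarrow> nat \<Rightarrow> nat \<Rightarrow> real \<Rightarrow> (nat \<Rightarrow> nat) list \<Rightarrow> bool" where
  "balanced p q n \<delta> H \<longleftrightarrow>
     (\<forall>b\<in>levels p q n. \<forall>u<b. real (collisions H b u) \<le> \<delta> * real (length H))"

definition potential :: "nat \<Rightarrow> nat \<Rightarrow> nat \<Rightarrow> real \<Rightarrow> (nat \<Rightarrow> nat) list \<Rightarrow> real" where
  "potential p q n x H = (\<Sum>b\<in>levels p q n. \<Sum>u<b. x ^ collisions H b u)"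

text \<open>The right side is the total over the \<open>q\<close> buckets of weight when all
  \<open>h u\<close> lie below \<open>q\<close>. A value with a lightest bucket then satisfies the
  inequality, being at most the average.\<close>

definition greedy_choice :: "nat \<Rightarrow> real \<Rightarrow> (nat \<Rightarrow> nat) list \<Rightarrow> (nat \<Rightarrow> nat) \<Rightarrow> nat \<Rightarrow> bool" where
  "greedy_choice q x H h b \<longleftrightarrow>
     real q * (\<Sum>u<b. if h b = h u then x ^ collisions H b u else 0) \<le> (\<Sum>u<b. x ^ collisions H b u)"

lemma levels_subset: "levels p q n \<subseteq> {..<n}"
  by (auto simp: levels_def)

lemma finite_levels [simp]: "finite (levels p q n)"
  using levels_subset by (rule finite_subset) simp

text \<open>Every pair is dominated by a pair \<open>(p ^ k, u)\<close>. If
  \<open>p ^ k < q\<close>, such a pair never collides because the functions are the identity there;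
  otherwise balance covers it.\<close>

lemma dense_phf_of_balanced:
  assumes "prime p" "H \<noteq> []" "\<epsilon> > 0" "pairs_plus_one d > 0"
    and H: "\<And>h. h \<in> set H \<Longrightarrow> hash_function p q n h" and qn: "q \<le> n"
    and bal: "balanced p q n (\<epsilon> / pairs_plus_one d) H"
  shows "dense_phf (1 - \<epsilon>) n q d H"
proof (rule dense_phf_of_collisions)
  fix x y assume "x < n" "y < n" "x \<noteq> y"
  from digit_additive_collision[OF assms(1) this(3,1,2)]
  obtain k u where ku: "p ^ k < n" "u < p ^ k"
    "\<And>h. digit_additive p n h \<Longrightarrow> h x = h y \<Longrightarrow> h (p ^ k) = h u" by blast
  have le: "collisions H x y \<le> collisions H (p ^ k) u"
    using H ku(3) by (intro collisions_mono) (auto simp: hash_function_def)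
  have "real (collisions H (p ^ k) u) \<le> \<epsilon> / pairs_plus_one d * real (length H)"
  proof (cases "q \<le> p ^ k")
    case True
    then have "p ^ k \<in> levels p q n" using ku(1) by (auto simp: levels_def)
    then show ?thesis using bal ku(2) by (auto simp: balanced_def)
  next
    case False
    then have "h (p ^ k) \<noteq> h u" if "h \<in> set H" for h
      using H[OF that] ku(2) by (auto simp: hash_function_def)
    then have "collisions H (p ^ k) u = 0" by (auto simp: collisions_def filter_empty_conv)
    then show ?thesis using assms(3,4) by simp
  qed
  then have "real (collisions H x y) \<le> \<epsilon> / pairs_plus_one d * real (length H)"
    using le by linarith
  then show "real (collisions H x y) * pairs_plus_one d \<le> \<epsilon> * real (length H)"
    using assms(4) by (simp add: field_simps)
qed (use assms(2,3) H in \<open>auto simp: hash_function_def\<close>)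

lemma potential_Nil: "potential p q n x [] \<le> real n ^ 2"
proof -
  have "potential p q n x [] = (\<Sum>b\<in>levels p q n. real b)"
    by (simp add: potential_def)
  also have "\<dots> \<le> (\<Sum>b<n. real b)"
    by (intro sum_mono2 levels_subset) auto
  also have "\<dots> \<le> real (card {..<n}) * real n"
    by (rule sum_bounded_above) auto
  finally show ?thesis by (simp add: power2_eq_square)
qed

text \<open>A collision multiplies a weight by \<open>x\<close>, that is, adds \<open>x - 1\<close>
  times the weight; the greedy choice keeps the colliding weight to a share of at most
  \<open>1 / q\<close> at every level.\<close>

lemma potential_snoc:
  assumes "x \<ge> 1" "q > 0" "\<And>b. b \<in> levels p q n \<Longrightarrow> greedy_choice q x H h b"
  shows "potential p q n x (H @ [h]) \<le> (1 + (x - 1) / real q) * potential p q n x H"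
proof -
  have "(\<Sum>u<b. x ^ collisions (H @ [h]) b u) \<le> (1 + (x - 1) / real q) * (\<Sum>u<b. x ^ collisions H b u)"
    if b: "b \<in> levels p q n" for b
  proof -
    let ?w = "\<lambda>u. x ^ collisions H b u"
    have "(\<Sum>u<b. if h b = h u then ?w u else 0) \<le> (\<Sum>u<b. ?w u) / real q"
      using assms(3)[OF b] assms(2) by (simp add: greedy_choice_def field_simps)
    then have "(x - 1) * (\<Sum>u<b. if h b = h u then ?w u else 0) \<le> (x - 1) * ((\<Sum>u<b. ?w u) / real q)"
      using assms(1) by (intro mult_left_mono) auto
    moreover have "(\<Sum>u<b. x ^ collisions (H @ [h]) b u)
        = (\<Sum>u<b. ?w u + (x - 1) * (if h b = h u then ?w u else 0))"
      by (intro sum.cong) (auto simp: algebra_simps)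
    moreover have "(\<Sum>u<b. ?w u + (x - 1) * (if h b = h u then ?w u else 0))
        = (\<Sum>u<b. ?w u) + (x - 1) * (\<Sum>u<b. if h b = h u then ?w u else 0)"
      by (simp only: sum.distrib sum_distrib_left)
    ultimately show ?thesis
      by (simp add: distrib_right)
  qed
  then show ?thesis
    unfolding potential_def by (simp add: sum_distrib_left sum_mono)
qed

text \<open>An overloaded pair alone weighs more than \<open>x\<close> to the power
  \<open>x / q * length H\<close>, whereas \<open>ln (1 + y) <= y\<close> bounds the logarithm of
  the whole potential. Comparing logarithms limits the length.\<close>

lemma length_of_unbalanced:
  assumes "x > 1" "q > 0" "n > 0"
    and pot: "potential p q n x H \<le> real n ^ 2 * (1 + (x - 1) / real q) ^ length H"
    and unbal: "\<not> balanced p q n (x / real q) H"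
  shows "real (length H) * (x / real q * (ln x - 1 + 1 / x)) < 2 * ln (real n)"
proof -
  let ?m = "real (length H)"
  obtain b u where bu: "b \<in> levels p q n" "u < b" "real (collisions H b u) > x / real q * ?m"
    using unbal by (auto simp: balanced_def not_le)
  have n1: "n > 1" using bu by (auto simp: levels_def)
  have "x ^ collisions H b u \<le> (\<Sum>u<b. x ^ collisions H b u)"
    using bu(2) assms(1) by (intro member_le_sum) auto
  also have "\<dots> \<le> potential p q n x H"
    unfolding potential_def using bu(1) assms(1) by (intro member_le_sum) (auto intro!: sum_nonneg)
  also note pot
  finally have "ln (x ^ collisions H b u) \<le> ln (real n ^ 2 * (1 + (x - 1) / real q) ^ length H)"
    using assms(1-3) by (subst ln_le_cancel_iff) (auto intro!: mult_pos_pos zero_less_power add_pos_nonneg)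
  also have "ln (real n ^ 2 * (1 + (x - 1) / real q) ^ length H)
      = 2 * ln (real n) + ?m * ln (1 + (x - 1) / real q)"
  proof -
    have "1 + (x - 1) / real q > 0" using assms(1,2) by (intro add_pos_nonneg) auto
    then show ?thesis using assms(3) by (simp add: ln_mult ln_realpow)
  qed
  also have "?m * ln (1 + (x - 1) / real q) \<le> ?m * ((x - 1) / real q)"
    using assms(1,2) by (intro mult_left_mono ln_add_one_self_le_self) auto
  also have "(x - 1) / real q = x / real q * (1 - 1 / x)"
    using assms(1,2) by (simp add: field_simps)
  also have "ln (x ^ collisions H b u) = real (collisions H b u) * ln x"
    using assms(1) by (simp add: ln_realpow)
  finally have "real (collisions H b u) * ln x
      \<le> 2 * ln (real n) + ?m * (x / real q * (1 - 1 / x))" by simp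
  moreover have "x / real q * ?m * ln x < real (collisions H b u) * ln x"
    using bu(3) assms(1) by (intro mult_strict_right_mono) auto
  ultimately show ?thesis by (simp add: algebra_simps)
qed

section \<open>Numerical estimates for the two size bounds\<close>

lemma pairs_plus_one_pos: "pairs_plus_one d > 0"
  and pairs_plus_one_le: "d > 0 \<Longrightarrow> pairs_plus_one d \<le> real d ^ 2"
proof -
  show "pairs_plus_one d > 0"
    by (cases d) (auto simp: pairs_plus_one_def add_nonneg_pos)
  assume "d > 0"
  then have d: "real d \<ge> 1" by simp
  then have "real d * real d \<ge> 1 * 1" by (intro mult_mono) auto
  with d have "real d + real d * real d \<ge> 2" by linarith
  then show "pairs_plus_one d \<le> real d ^ 2"
    by (simp add: pairs_plus_one_def power2_eq_square field_simps)
qed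

text \<open>Both sides agree at 1, and their difference has the nonnegative derivative
  \<open>(1 - 1 / y) ^ 2 / y\<close> from there on.\<close>

lemma ln_ge_quadratic:
  assumes "x \<ge> (1::real)"
  shows "ln x \<ge> (1 - 1 / x) + (1 - 1 / x) ^ 2 / 2"
proof -
  define f where "f x = ln x - (1 - 1 / x) - (1 - 1 / x) ^ 2 / 2" for x :: real
  have "f 1 \<le> f x"
  proof (rule DERIV_nonneg_imp_nondecreasing[OF assms])
    fix y :: real assume "1 \<le> y" "y \<le> x"
    then have "(f has_real_derivative (1 - 1 / y) ^ 2 / y) (at y)"
      unfolding f_def
      by (auto intro!: derivative_eq_intros simp: field_simps power2_eq_square)
    then show "\<exists>z. (f has_real_derivative z) (at y) \<and> z \<ge> 0"
      using \<open>1 \<le> y\<close> by (intro exI[of _ "(1 - 1 / y) ^ 2 / y"]) auto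
  qed
  then show ?thesis by (simp add: f_def)
qed

text \<open>Here \<open>m\<close> stands for the length of the family, and \<open>m - 1\<close>
  appears since the length limit applies before the last function is added. Any positive lower bound
  \<open>g\<close> of \<open>ln x - 1 + 1 / x\<close> yields a size bound; the factor
  \<open>d ^ 2\<close> dominates \<open>pairs_plus_one d\<close>.\<close>

lemma scaled_length_bound:
  assumes "d > 0" "\<epsilon> > 0" "n > 0" "q > 0" and x: "x = \<epsilon> * real q / pairs_plus_one d"
    and g: "g > 0" "g \<le> ln x - 1 + 1 / x"
    and m: "(m - 1) * (x / real q * (ln x - 1 + 1 / x)) \<le> 2 * ln (real n)" "m \<ge> 1"
  shows "m \<le> 1 + 2 * (real d ^ 2 * ln (real n) / (\<epsilon> * g))"
proof -
  let ?P = "pairs_plus_one d"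
  have P: "?P > 0" "?P \<le> real d ^ 2" using pairs_plus_one_pos pairs_plus_one_le assms(1) by auto
  have xq: "x / real q = \<epsilon> / ?P" using x assms(4) by simp
  have "(m - 1) * (\<epsilon> / ?P * g) \<le> (m - 1) * (x / real q * (ln x - 1 + 1 / x))"
    unfolding xq using g m(2) assms(2) P by (intro mult_left_mono) auto
  also note m(1)
  finally have "(m - 1) * (\<epsilon> * g) \<le> 2 * ln (real n) * ?P"
    using P by (simp add: field_simps)
  also have "\<dots> \<le> 2 * ln (real n) * real d ^ 2"
    using P assms(3) by (intro mult_left_mono) auto
  finally have "m - 1 \<le> 2 * ln (real n) * real d ^ 2 / (\<epsilon> * g)"
    using g assms(2) by (simp add: pos_le_divide_eq)
  then show ?thesis by (simp add: algebra_simps)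
qed

text \<open>For \<open>x > 4\<close> the number \<open>ln x - 1 = ln (x / exp 1)\<close> is positive
  and serves as \<open>g\<close>; it is the logarithm in the claimed bound.\<close>

lemma length_le_large:
  assumes "d > 0" "\<epsilon> > 0" "n > 0" "q > 0" and x: "x = \<epsilon> * real q / pairs_plus_one d"
    and m: "(m - 1) * (x / real q * (ln x - 1 + 1 / x)) \<le> 2 * ln (real n)" "m \<ge> 1"
    and large: "\<epsilon> > 4 * pairs_plus_one d / real q"
  shows "m \<le> 5 * max 1 (size_large_eps n q d \<epsilon>)"
proof -
  have x4: "x > 4" using large assms(4) pairs_plus_one_pos[of d] by (simp add: x field_simps)
  have "ln (exp 1) < ln x"
    using exp_le x4 by (subst ln_less_cancel_iff) (auto simp: less_le_trans)
  then have "ln (x / exp 1) > 0" using x4 by (simp add: ln_div)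
  moreover have "ln (x / exp 1) \<le> ln x - 1 + 1 / x" using x4 by (simp add: ln_div)
  ultimately have "m \<le> 1 + 2 * (real d ^ 2 * ln (real n) / (\<epsilon> * ln (x / exp 1)))"
    using scaled_length_bound[OF assms(1-5) _ _ m] by blast
  also have "real d ^ 2 * ln (real n) / (\<epsilon> * ln (x / exp 1)) = size_large_eps n q d \<epsilon>"
    by (simp add: size_large_eps_def x mult.commute)
  finally show ?thesis by linarith
qed

text \<open>Here \<open>g\<close> is half the square of \<open>1 - 1 / x\<close>, and
  \<open>q * (1 - 1 / x) = q - pairs_plus_one d / \<epsilon>\<close>. Halving doubles the bound,
  whence the constant \<open>1 + 4 = 5\<close>, which \<open>length_le_large\<close> shares.\<close>

lemma length_le_small:
  assumes "d > 0" "\<epsilon> > 0" "n > 0" "q > 0" and x: "x = \<epsilon> * real q / pairs_plus_one d"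
    and m: "(m - 1) * (x / real q * (ln x - 1 + 1 / x)) \<le> 2 * ln (real n)" "m \<ge> 1"
    and x1: "x > 1"
  shows "m \<le> 5 * max 1 (size_small_eps n q d \<epsilon>)"
proof -
  let ?P = "pairs_plus_one d"
  let ?y = "1 - 1 / x"
  have "?y ^ 2 / 2 > 0" using x1 by simp
  moreover have "?y ^ 2 / 2 \<le> ln x - 1 + 1 / x" using ln_ge_quadratic[of x] x1 by simp
  ultimately have "m \<le> 1 + 2 * (real d ^ 2 * ln (real n) / (\<epsilon> * (?y ^ 2 / 2)))"
    using scaled_length_bound[OF assms(1-5) _ _ m] by blast
  also have "real d ^ 2 * ln (real n) / (\<epsilon> * (?y ^ 2 / 2)) = 2 * size_small_eps n q d \<epsilon>"
  proof -
    have "real q - ?P / \<epsilon> = real q * ?y"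
      using assms(2,4) pairs_plus_one_pos[of d] by (simp add: x field_simps)
    then show ?thesis
      using assms(4) by (simp add: size_small_eps_def power_mult_distrib)
  qed
  finally show ?thesis by linarith
qed

section \<open>Timed total correctness\<close>

text \<open>The word bound depends on the length of the final family, which is unknown while the
  earlier rounds run; their executions are lifted to it afterwards.\<close>

lemma exec_mono: "exec W P s t s' \<Longrightarrow> W \<le> W' \<Longrightarrow> exec W' P s t s'"
  by (induction rule: exec.induct) (blast intro: exec.intros less_le_trans)+

definition runs :: "nat \<Rightarrow> prog \<Rightarrow> store \<Rightarrow> nat \<Rightarrow> (store \<Rightarrow> bool) \<Rightarrow> bool" where
  "runs W P s \<tau> Q \<longleftrightarrow> (\<exists>t s'. exec W P s t s' \<and> t \<le> \<tau> \<and> Q s')"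

lemma runs_mono:
  "runs W P s \<tau> Q \<Longrightarrow> \<tau> \<le> \<tau>' \<Longrightarrow> (\<And>s'. Q s' \<Longrightarrow> Q' s') \<Longrightarrow> runs W P s \<tau>' Q'"
  unfolding runs_def using le_trans by blast

lemma runs_Skip: "Q s \<Longrightarrow> runs W Skip s \<tau> Q"
  unfolding runs_def using exec_Skip by blast

lemma runs_Out: "wval e s < W \<Longrightarrow> Q (s\<lparr>outp := outp s @ [wval e s]\<rparr>) \<Longrightarrow> 1 \<le> \<tau> \<Longrightarrow>
    runs W (Out e) s \<tau> Q"
  unfolding runs_def using exec_Out by blast

lemma runs_Seq:
  assumes "runs W P s \<tau>1 Q" "\<And>s'. Q s' \<Longrightarrow> runs W P' s' \<tau>2 Q'"
  shows "runs W (Seq P P') s (\<tau>1 + \<tau>2) Q'"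
proof -
  obtain t s' where 1: "exec W P s t s'" "t \<le> \<tau>1" "Q s'"
    using assms(1) by (auto simp: runs_def)
  then obtain u s'' where 2: "exec W P' s' u s''" "u \<le> \<tau>2" "Q' s''"
    using assms(2)[OF 1(3)] by (auto simp: runs_def)
  show ?thesis
    unfolding runs_def using exec_Seq[OF 1(1) 2(1)] 1 2 add_mono by blast
qed

lemma runs_Cond:
  assumes "tval b s \<Longrightarrow> runs W P s \<tau> Q" "\<not> tval b s \<Longrightarrow> runs W P' s \<tau> Q"
  shows "runs W (Cond b P P') s (Suc \<tau>) Q"
  using assms unfolding runs_def by (meson Suc_le_mono exec_CondF exec_CondT)

text \<open>The function \<open>f\<close> is a variant and a time budget at once. Its strict
  decrease pays for the test of every iteration, the extra 1 for the last test.\<close>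

lemma runs_Loop:
  assumes "I s"
    and step: "\<And>s. I s \<Longrightarrow> tval b s \<Longrightarrow> \<exists>\<tau>. runs W P s \<tau> (\<lambda>s'. I s' \<and> \<tau> + f s' < f s)"
  shows "runs W (Loop b P) s (f s + 1) (\<lambda>s'. I s' \<and> \<not> tval b s')"
  using assms(1)
proof (induction "f s" arbitrary: s rule: less_induct)
  case less
  show ?case
  proof (cases "tval b s")
    case True
    then obtain \<tau> t s' where 1: "exec W P s t s'" "t \<le> \<tau>" "I s'" "\<tau> + f s' < f s"
      using step[OF less.prems] by (auto simp: runs_def)
    then have "runs W (Loop b P) s' (f s' + 1) (\<lambda>s'. I s' \<and> \<not> tval b s')"
      by (intro less.hyps) auto
    then obtain u s'' where 2: "exec W (Loop b P) s' u s''" "u \<le> f s' + 1" "I s''" "\<not> tval b s''"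
      by (auto simp: runs_def)
    have "Suc (t + u) \<le> f s + 1" using 1 2 by linarith
    then show ?thesis
      unfolding runs_def using exec_LoopT[OF True 1(1) 2(1)] 2 by blast
  next
    case False
    then show ?thesis
      unfolding runs_def using exec_LoopF[OF False, of W P] less.prems
      by (intro exI[of _ 1] exI[of _ s]) simp
  qed
qed

text \<open>
  The flat memory is divided into 16 arrays; array \<open>k\<close> holds its entry \<open>i\<close> at address
  \<open>k + 16 * i\<close>, and scalars are entries 0. Thus the three input words are entries 0 of the
  word arrays 0, 1 and 2.
\<close>

definition adr :: "nat \<Rightarrow> nat \<Rightarrow> nat" where
  "adr k i = k + 16 * i"

lemma adr_eq_iff [simp]: "k < 16 \<Longrightarrow> k' < 16 \<Longrightarrow> adr k i = adr k' i' \<longleftrightarrow> k = k' \<and> i = i'"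
proof -
  assume "k < 16" "k' < 16"
  then have "adr k i mod 16 = k" "adr k i div 16 = i" "adr k' i' mod 16 = k'" "adr k' i' div 16 = i'"
    by (simp_all add: adr_def)
  then show ?thesis by metis
qed

definition wget :: "store \<Rightarrow> nat \<Rightarrow> nat \<Rightarrow> nat" where
  "wget s k i = words s (adr k i)"

definition rget :: "store \<Rightarrow> nat \<Rightarrow> nat \<Rightarrow> real" where
  "rget s k i = reals s (adr k i)"

definition wset :: "nat \<Rightarrow> nat \<Rightarrow> nat \<Rightarrow> store \<Rightarrow> store" where
  "wset k i v s = s\<lparr>words := (words s)(adr k i := v)\<rparr>"

definition rset :: "nat \<Rightarrow> nat \<Rightarrow> real \<Rightarrow> store \<Rightarrow> store" where
  "rset k i v s = s\<lparr>reals := (reals s)(adr k i := v)\<rparr>"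

lemma get_set [simp]:
  "k < 16 \<Longrightarrow> k' < 16 \<Longrightarrow> wget (wset k i v s) k' i' = (if k = k' \<and> i = i' then v else wget s k' i')"
  "k < 16 \<Longrightarrow> k' < 16 \<Longrightarrow> rget (rset k i z s) k' i' = (if k = k' \<and> i = i' then z else rget s k' i')"
  "wget (rset k i z s) k' i' = wget s k' i'"
  "rget (wset k i v s) k' i' = rget s k' i'"
  "outp (wset k i v s) = outp s" "outp (rset k i z s) = outp s"
  by (auto simp: wget_def rget_def wset_def rset_def)

lemma get_outp [simp]:
  "wget (s\<lparr>outp := xs\<rparr>) k i = wget s k i" "rget (s\<lparr>outp := xs\<rparr>) k i = rget s k i"
  by (simp_all add: wget_def rget_def)

definition Addr :: "nat \<Rightarrow> wexp \<Rightarrow> wexp" where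
  "Addr k e = WAdd (Lit k) (WMul (Lit 16) e)"

definition At :: "nat \<Rightarrow> wexp \<Rightarrow> wexp" where
  "At k e = WCell (Addr k e)"

definition RAt :: "nat \<Rightarrow> wexp \<Rightarrow> rexp" where
  "RAt k e = RCell (Addr k e)"

definition Put :: "nat \<Rightarrow> wexp \<Rightarrow> wexp \<Rightarrow> prog" where
  "Put k a e = WSet (Addr k a) e"

definition RPut :: "nat \<Rightarrow> wexp \<Rightarrow> rexp \<Rightarrow> prog" where
  "RPut k a e = RSet (Addr k a) e"

abbreviation Var :: "nat \<Rightarrow> wexp" where "Var k \<equiv> At k (Lit 0)"
abbreviation RVar :: "nat \<Rightarrow> rexp" where "RVar k \<equiv> RAt k (Lit 0)"
abbreviation Assign :: "nat \<Rightarrow> wexp \<Rightarrow> prog" where "Assign k \<equiv> Put k (Lit 0)"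
abbreviation RAssign :: "nat \<Rightarrow> rexp \<Rightarrow> prog" where "RAssign k \<equiv> RPut k (Lit 0)"

lemma val_At [simp]:
  "wval (At k e) s = wget s k (wval e s)" "rval (RAt k e) s = rget s k (wval e s)"
  by (simp_all add: At_def RAt_def Addr_def wget_def rget_def adr_def)

lemma runs_Put: "adr k (wval a s) < W \<Longrightarrow> wval e s < W \<Longrightarrow> Q (wset k (wval a s) (wval e s) s) \<Longrightarrow>
    1 \<le> \<tau> \<Longrightarrow> runs W (Put k a e) s \<tau> Q"
  using exec_WSet[of "Addr k a" s W e]
  unfolding runs_def Put_def by (auto simp: Addr_def adr_def wset_def)

lemma runs_RPut: "adr k (wval a s) < W \<Longrightarrow> Q (rset k (wval a s) (rval e s) s) \<Longrightarrow>
    1 \<le> \<tau> \<Longrightarrow> runs W (RPut k a e) s \<tau> Q"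
  using exec_RSet[of "Addr k a" s W e]
  unfolding runs_def RPut_def by (auto simp: Addr_def adr_def rset_def)

section \<open>Frame conditions and counting loops\<close>

definition frame :: "nat set \<Rightarrow> nat set \<Rightarrow> store \<Rightarrow> store \<Rightarrow> bool" where
  "frame K R s s' \<longleftrightarrow>
     (\<forall>k<16. k \<notin> K \<longrightarrow> (\<forall>i. wget s' k i = wget s k i)) \<and>
     (\<forall>k<16. k \<notin> R \<longrightarrow> (\<forall>i. rget s' k i = rget s k i)) \<and> outp s' = outp s"

lemma frame_refl [simp]: "frame K R s s"
  by (simp add: frame_def)

lemma frame_trans: "frame K R s s' \<Longrightarrow> frame K' R' s' s'' \<Longrightarrow> frame (K \<union> K') (R \<union> R') s s''"
  by (simp add: frame_def)

lemma frame_set [simp]: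
  "k < 16 \<Longrightarrow> k \<in> K \<Longrightarrow> frame K R s (wset k i v s') \<longleftrightarrow> frame K R s s'"
  "k < 16 \<Longrightarrow> k \<in> R \<Longrightarrow> frame K R s (rset k i z s') \<longleftrightarrow> frame K R s s'"
  by (auto simp: frame_def)

lemma frame_wget: "frame K R s s' \<Longrightarrow> k < 16 \<Longrightarrow> k \<notin> K \<Longrightarrow> wget s' k i = wget s k i"
  and frame_rget: "frame K R s s' \<Longrightarrow> k < 16 \<Longrightarrow> k \<notin> R \<Longrightarrow> rget s' k i = rget s k i"
  and frame_outp: "frame K R s s' \<Longrightarrow> outp s' = outp s"
  by (simp_all add: frame_def)

definition For :: "wexp \<Rightarrow> wexp \<Rightarrow> prog \<Rightarrow> prog" where
  "For lo hi P = Seq (Assign 5 lo)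
     (Loop (WLess (Var 5) hi) (Seq P (Assign 5 (WAdd (Var 5) (Lit 1)))))"

text \<open>The invariant is required with the counter already advanced, and \<open>hi\<close> must
  keep its value because it is evaluated anew at each test. Each iteration costs 2 steps beyond the
  body, for the increment and the test; the final 2 are the initial assignment and the failing
  test.\<close>

lemma runs_For:
  assumes W: "16 \<le> W" "N < W" and lo: "wval lo s = l" "l \<le> N"
    and init: "J l (wset 5 0 l s)"
    and hi: "\<And>i s. J i s \<Longrightarrow> wget s 5 0 = i \<Longrightarrow> wval hi s = N"
    and step: "\<And>i s. l \<le> i \<Longrightarrow> i < N \<Longrightarrow> J i s \<Longrightarrow> wget s 5 0 = i \<Longrightarrow>
      runs W P s \<tau> (\<lambda>s'. wget s' 5 0 = i \<and> J (Suc i) (wset 5 0 (Suc i) s'))"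
  shows "runs W (For lo hi P) s ((N - l) * (\<tau> + 2) + 2) (J N)"
proof -
  define I where "I s \<longleftrightarrow> l \<le> wget s 5 0 \<and> wget s 5 0 \<le> N \<and> J (wget s 5 0) s" for s
  define f where "f s = (N - wget s 5 0) * (\<tau> + 2)" for s
  let ?s = "wset 5 0 l s"
  have "runs W (Loop (WLess (Var 5) hi) (Seq P (Assign 5 (WAdd (Var 5) (Lit 1))))) ?s (f ?s + 1)
      (\<lambda>s'. I s' \<and> \<not> tval (WLess (Var 5) hi) s')"
  proof (rule runs_Loop[of I])
    show "I ?s" using init lo by (simp add: I_def)
  next
    fix s assume I: "I s" and less: "tval (WLess (Var 5) hi) s"
    let ?i = "wget s 5 0"
    have i: "?i < N" "J ?i s" "l \<le> ?i" using I hi[of ?i s] less by (auto simp: I_def)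
    have "runs W (Seq P (Assign 5 (WAdd (Var 5) (Lit 1)))) s (\<tau> + 1)
        (\<lambda>s'. I s' \<and> \<tau> + 1 + f s' < f s)"
    proof (rule runs_Seq[OF step[OF i(3,1,2) refl]])
      fix s' assume s': "wget s' 5 0 = ?i \<and> J (Suc ?i) (wset 5 0 (Suc ?i) s')"
      have "N - ?i = Suc (N - Suc ?i)" using i(1) by simp
      then have "\<tau> + 1 + f (wset 5 0 (Suc ?i) s') < f s" by (simp add: f_def)
      then show "runs W (Assign 5 (WAdd (Var 5) (Lit 1))) s' 1 (\<lambda>s'. I s' \<and> \<tau> + 1 + f s' < f s)"
        using s' i W by (intro runs_Put) (auto simp: I_def adr_def)
    qed
    then show "\<exists>\<tau>. runs W (Seq P (Assign 5 (WAdd (Var 5) (Lit 1)))) s \<tau> (\<lambda>s'. I s' \<and> \<tau> + f s' < f s)"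
      by blast
  qed
  then have loop: "runs W (Loop (WLess (Var 5) hi) (Seq P (Assign 5 (WAdd (Var 5) (Lit 1))))) ?s (f ?s + 1) (J N)"
  proof (rule runs_mono)
    fix s' assume s': "I s' \<and> \<not> tval (WLess (Var 5) hi) s'"
    then have "wget s' 5 0 = N" using hi[of "wget s' 5 0" s'] by (auto simp: I_def)
    with s' show "J N s'" by (auto simp: I_def)
  qed simp
  have "runs W (For lo hi P) s (1 + (f ?s + 1)) (J N)"
    unfolding For_def
    by (rule runs_Seq[of _ _ _ _ "\<lambda>s'. s' = ?s"], rule runs_Put) (use loop lo W in \<open>auto simp: adr_def\<close>)
  then show ?thesis by (simp add: f_def)
qed

section \<open>The program and its verification\<close>

text \<open>
  Registers of the program. Words: 0, 1, 2 the input \<open>n\<close>, \<open>q\<close>, \<open>d\<close>; 3 the prime \<open>p\<close>; 4 the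
  current power \<open>b\<close> of \<open>p\<close>; 5 loop counter; 6 the value \<open>a\<close> chosen for \<open>b\<close>; 7 number of
  functions printed so far; 8 table of the current function; 9 table of digitwise addition of
  \<open>a\<close> modulo \<open>p\<close>; 10 entry \<open>b + u\<close> counts the functions that agree on \<open>b\<close> and \<open>u < b\<close>; 11 and 12
  auxiliary; 13 flag of the main loop. Reals: 0 the input \<open>\<epsilon>\<close>; 1 the weight
  factor \<open>x\<close>; 2 entry \<open>b + u\<close> is \<open>x\<close> to the power of the count; 3 total weight of the \<open>u < b\<close> with
  a given hash value.
\<close>

definition clear_buckets :: prog where
  "clear_buckets = For (Lit 0) (Var 1) (RPut 3 (Var 5) (OfWord (Lit 0)))"

definition fill_buckets :: prog where
  "fill_buckets = For (Lit 0) (Var 4) (RPut 3 (At 8 (Var 5))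
     (RAdd (RAt 3 (At 8 (Var 5))) (RAt 2 (WAdd (Var 4) (Var 5)))))"

definition choose_value :: prog where
  "choose_value = Seq (Assign 6 (Lit 0)) (For (Lit 1) (Var 1)
     (Cond (RLess (RAt 3 (Var 5)) (RAt 3 (Var 6))) (Assign 6 (Var 5)) Skip))"

definition Incr :: "wexp \<Rightarrow> wexp \<Rightarrow> wexp \<Rightarrow> wexp" where
  "Incr p e y = WAdd (WAdd (WMul (WDiv y (WMul e p)) (WMul e p))
     (WMul (WMod (WAdd (WDiv y e) (Lit 1)) p) e)) (WMod y e)"

text \<open>Word 11 follows the largest power of \<open>p\<close> not exceeding the counter
  \<open>v\<close>. As \<open>v\<close> arises from \<open>v\<close> minus this power by
  incrementing one digit, so does its digitwise sum with \<open>a\<close>. Thus each entry takes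
  constant time.\<close>

definition tabulate_addition :: prog where
  "tabulate_addition = Seq (Put 9 (Lit 0) (Var 6)) (Seq (Assign 11 (Lit 1)) (For (Lit 1) (Var 1)
     (Seq (Cond (WLess (Var 5) (WMul (Var 11) (Var 3))) Skip (Assign 11 (WMul (Var 11) (Var 3))))
          (Put 9 (Var 5) (Incr (Var 3) (Var 11) (At 9 (WSub (Var 5) (Var 11))))))))"

definition extend_table :: prog where
  "extend_table = Seq (Assign 12 (WMul (Var 4) (Var 3)))
     (Seq (Cond (WLess (Var 0) (Var 12)) (Assign 12 (Var 0)) Skip)
          (For (Var 4) (Var 12) (Put 8 (Var 5) (At 9 (At 8 (WSub (Var 5) (Var 4)))))))"

text \<open>The language tests only \<open><\<close>; two words are equal iff their truncated
  differences in both directions add up to less than 1.\<close>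

definition update_weights :: prog where
  "update_weights = For (Lit 0) (Var 4)
     (Cond (WLess (WAdd (WSub (At 8 (Var 5)) (Var 6)) (WSub (Var 6) (At 8 (Var 5)))) (Lit 1))
       (Seq (Put 10 (WAdd (Var 4) (Var 5)) (WAdd (At 10 (WAdd (Var 4) (Var 5))) (Lit 1)))
            (RPut 2 (WAdd (Var 4) (Var 5)) (RMul (RAt 2 (WAdd (Var 4) (Var 5))) (RVar 1))))
       Skip)"

lemma val_Incr [simp]: "wval (Incr p e y) s = incr_digit (wval p s) (wval e s) (wval y s)"
  by (simp add: Incr_def incr_digit_def)

locale digit_hashing =
  fixes n q p r :: nat
  assumes prime: "prime p" and q: "q = p ^ r" and q_less: "q < n"
begin

lemma p2: "p \<ge> 2"
  using prime by (rule prime_ge_2_nat)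

lemma q_pos: "q > 0"
  using p2 q by simp

end

text \<open>Arrays have indices up to \<open>2 * n\<close>, so addresses stay below
  \<open>32 * n + 16\<close>. The second bound accommodates the power \<open>b * p <= n * q\<close>
  that follows a power \<open>b < n\<close>.\<close>

locale word_bounds = digit_hashing +
  fixes W :: nat
  assumes W: "32 * n + 16 \<le> W" "n * q < W"
begin

lemma n_less: "n < W"
  using W by simp

lemma adr_less: "k < 16 \<Longrightarrow> i \<le> 2 * n \<Longrightarrow> adr k i < W"
  using W by (simp add: adr_def)

section \<open>Verification of the steps for one power of \<open>p\<close>\<close>

lemma runs_clear_buckets:
  assumes "wget s 1 0 = q"
  shows "runs W clear_buckets s (3 * q + 2) (\<lambda>s'. frame {5} {3} s s' \<and> (\<forall>v<q. rget s' 3 v = 0))"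
proof -
  define J where "J i s' \<longleftrightarrow> frame {5} {3} s s' \<and> (\<forall>v<i. rget s' 3 v = 0)" for i s'
  have "runs W clear_buckets s ((q - 0) * (1 + 2) + 2) (J q)"
    unfolding clear_buckets_def
  proof (rule runs_For)
    fix i s' assume i: "i < q" and J: "J i s'" "wget s' 5 0 = i"
    then show "runs W (RPut 3 (Var 5) (OfWord (Lit 0))) s' 1
        (\<lambda>s'. wget s' 5 0 = i \<and> J (Suc i) (wset 5 0 (Suc i) s'))"
      using q_less by (intro runs_RPut) (auto simp: J_def less_Suc_eq intro!: adr_less)
  qed (use W q_less assms in \<open>auto simp: J_def frame_wget\<close>)
  then show ?thesis
    by (rule runs_mono) (auto simp: J_def)
qed

lemma runs_fill_buckets:
  assumes "wget s 4 0 = b" "b \<le> n" "\<And>u. u < b \<Longrightarrow> wget s 8 u < q"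
  shows "runs W fill_buckets s (3 * b + 2) (\<lambda>s'. frame {5} {3} s s' \<and>
    (\<forall>v. rget s' 3 v = rget s 3 v + (\<Sum>u<b. if wget s 8 u = v then rget s 2 (b + u) else 0)))"
proof -
  define J where "J i s' \<longleftrightarrow> frame {5} {3} s s' \<and>
    (\<forall>v. rget s' 3 v = rget s 3 v + (\<Sum>u<i. if wget s 8 u = v then rget s 2 (b + u) else 0))" for i s'
  have "runs W fill_buckets s ((b - 0) * (1 + 2) + 2) (J b)"
    unfolding fill_buckets_def
  proof (rule runs_For)
    fix i s' assume i: "i < b" and J: "J i s'" "wget s' 5 0 = i"
    have "wget s' 8 i = wget s 8 i" "wget s' 4 0 = b" "rget s' 2 (b + i) = rget s 2 (b + i)"
      using J assms(1) by (auto simp: J_def frame_wget frame_rget)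
    then show "runs W (RPut 3 (At 8 (Var 5)) (RAdd (RAt 3 (At 8 (Var 5))) (RAt 2 (WAdd (Var 4) (Var 5))))) s' 1
        (\<lambda>s'. wget s' 5 0 = i \<and> J (Suc i) (wset 5 0 (Suc i) s'))"
      using q_less J assms(3)[OF i] by (intro runs_RPut) (auto simp: J_def intro!: adr_less)
  qed (use W q_less assms in \<open>auto simp: J_def frame_wget\<close>)
  then show ?thesis
    by (rule runs_mono) (auto simp: J_def)
qed

lemma runs_choose_value:
  assumes "wget s 1 0 = q"
  shows "runs W choose_value s (4 * q + 3) (\<lambda>s'. frame {5, 6} {} s s' \<and> wget s' 6 0 < q \<and>
    (\<forall>v<q. rget s' 3 (wget s' 6 0) \<le> rget s' 3 v))"
proof -
  define J where "J i s' \<longleftrightarrow> frame {5, 6} {} s s' \<and> wget s' 6 0 < i \<and>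
    (\<forall>v<i. rget s' 3 (wget s' 6 0) \<le> rget s' 3 v)" for i s'
  have "runs W choose_value s (1 + ((q - 1) * (2 + 2) + 2)) (J q)"
    unfolding choose_value_def
  proof (rule runs_Seq)
    show "runs W (Assign 6 (Lit 0)) s 1 (\<lambda>s'. frame {5, 6} {} s s' \<and> wget s' 6 0 = 0)"
      using W by (intro runs_Put) (auto simp: adr_def)
  next
    fix s1 assume s1: "frame {5, 6} {} s s1 \<and> wget s1 6 0 = 0"
    show "runs W (For (Lit 1) (Var 1) (Cond (RLess (RAt 3 (Var 5)) (RAt 3 (Var 6))) (Assign 6 (Var 5)) Skip))
        s1 ((q - 1) * (2 + 2) + 2) (J q)"
    proof (rule runs_For)
      fix i s' assume i: "1 \<le> i" "i < q" and J: "J i s'" "wget s' 5 0 = i"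
      have "runs W (Cond (RLess (RAt 3 (Var 5)) (RAt 3 (Var 6))) (Assign 6 (Var 5)) Skip) s' (Suc 1)
          (\<lambda>s'. wget s' 5 0 = i \<and> J (Suc i) (wset 5 0 (Suc i) s'))"
      proof (intro runs_Cond runs_Skip runs_Put)
        assume "tval (RLess (RAt 3 (Var 5)) (RAt 3 (Var 6))) s'"
        then have "rget s' 3 i < rget s' 3 (wget s' 6 0)" using J by simp
        moreover have "frame {5, 6} {} s s' \<and> (\<forall>v<i. rget s' 3 (wget s' 6 0) \<le> rget s' 3 v)"
          using J by (simp add: J_def)
        ultimately have "rget s' 3 i \<le> rget s' 3 v" if "v < Suc i" for v
          using that by (metis less_Suc_eq less_le_trans nle_le order_less_imp_le)
        then show "wget (wset 6 (wval (Lit 0) s') (wval (Var 5) s') s') 5 0 = i \<and>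
            J (Suc i) (wset 5 0 (Suc i) (wset 6 (wval (Lit 0) s') (wval (Var 5) s') s'))"
          using J by (simp add: J_def)
      qed (use i J q_less W in \<open>auto simp: J_def adr_def less_Suc_eq\<close>)
      then show "runs W (Cond (RLess (RAt 3 (Var 5)) (RAt 3 (Var 6))) (Assign 6 (Var 5)) Skip) s' 2
          (\<lambda>s'. wget s' 5 0 = i \<and> J (Suc i) (wset 5 0 (Suc i) s'))"
        by (simp add: numeral_2_eq_2)
    qed (use W q_less q_pos assms s1 in \<open>auto simp: J_def frame_wget\<close>)
  qed
  then show ?thesis
    by (rule runs_mono) (use q_pos in \<open>auto simp: J_def algebra_simps\<close>)
qed

lemma runs_tabulate_addition:
  assumes "wget s 1 0 = q" "wget s 3 0 = p" "wget s 6 0 = a" "a < q"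
  shows "runs W tabulate_addition s (5 * q + 4) (\<lambda>s'. frame {5, 9, 11} {} s s' \<and>
    (\<forall>v<q. wget s' 9 v < q \<and> (\<forall>j. digit p j (wget s' 9 v) = (digit p j v + digit p j a) mod p)))"
proof -
  \<comment> \<open>The bound \<open>i <= p ^ Suc k\<close> is not strict: when the counter reaches
    a new power, word 11 lags behind until the conditional in the body updates it. After that,
    \<open>Q\<close> has the strict bound.\<close>
  define J where "J i s' \<longleftrightarrow> frame {5, 9, 11} {} s s' \<and>
      (\<exists>k. wget s' 11 0 = p ^ k \<and> p ^ k \<le> i \<and> i \<le> p ^ Suc k) \<and>
      (\<forall>v<i. wget s' 9 v < q \<and> (\<forall>j. digit p j (wget s' 9 v) = (digit p j v + digit p j a) mod p))"
    for i s'
  let ?step = "Cond (WLess (Var 5) (WMul (Var 11) (Var 3))) Skip (Assign 11 (WMul (Var 11) (Var 3)))"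
  let ?put = "Put 9 (Var 5) (Incr (Var 3) (Var 11) (At 9 (WSub (Var 5) (Var 11))))"
  have "runs W tabulate_addition s (1 + (1 + ((q - 1) * (3 + 2) + 2))) (J q)"
    unfolding tabulate_addition_def
  proof (intro runs_Seq)
    show "runs W (Put 9 (Lit 0) (Var 6)) s 1 (\<lambda>s'. frame {5, 9, 11} {} s s' \<and> wget s' 9 0 = a)"
      using W assms q_less by (intro runs_Put) (auto simp: adr_def)
  next
    fix s1 assume "frame {5, 9, 11} {} s s1 \<and> wget s1 9 0 = a"
    then show "runs W (Assign 11 (Lit 1)) s1 1
        (\<lambda>s'. frame {5, 9, 11} {} s s' \<and> wget s' 9 0 = a \<and> wget s' 11 0 = 1)"
      using W by (intro runs_Put) (auto simp: adr_def)
  next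
    fix s1 assume s1: "frame {5, 9, 11} {} s s1 \<and> wget s1 9 0 = a \<and> wget s1 11 0 = 1"
    show "runs W (For (Lit 1) (Var 1) (Seq ?step ?put)) s1 ((q - 1) * (3 + 2) + 2) (J q)"
    proof (rule runs_For)
      have "\<exists>k. Suc 0 = p ^ k \<and> p ^ k \<le> Suc 0 \<and> Suc 0 \<le> p ^ Suc k"
        using p2 by (intro exI[of _ 0]) auto
      moreover have "digit p j a = digit p j a mod p" for j by (simp add: digit_def)
      ultimately show "J 1 (wset 5 0 1 s1)" using s1 assms(4) by (auto simp: J_def)
    next
      fix i s' assume i: "1 \<le> i" "i < q" and J: "J i s'" "wget s' 5 0 = i"
      obtain k0 where k0: "wget s' 11 0 = p ^ k0" "p ^ k0 \<le> i" "i \<le> p ^ Suc k0"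
        using J by (auto simp: J_def)
      have fr: "frame {5, 9, 11} {} s s'" using J by (simp add: J_def)
      define Q where "Q s2 \<longleftrightarrow> J i s2 \<and> wget s2 5 0 = i \<and>
        (\<exists>k. wget s2 11 0 = p ^ k \<and> p ^ k \<le> i \<and> i < p ^ Suc k)" for s2
      have p3: "wget s' 3 0 = p" using fr assms(2) by (simp add: frame_wget)
      have "runs W (Seq ?step ?put) s' (Suc 1 + 1)
          (\<lambda>s'. wget s' 5 0 = i \<and> J (Suc i) (wset 5 0 (Suc i) s'))"
      proof (rule runs_Seq)
        show "runs W ?step s' (Suc 1) Q"
        proof (intro runs_Cond runs_Skip runs_Put)
          assume "tval (WLess (Var 5) (WMul (Var 11) (Var 3))) s'"
          then show "Q s'" using J k0 p3 by (auto simp: Q_def mult.commute)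
        next
          assume "\<not> tval (WLess (Var 5) (WMul (Var 11) (Var 3))) s'"
          then have eq: "i = p ^ Suc k0" using J k0 p3 by (simp add: mult.commute)
          then show "wval (WMul (Var 11) (Var 3)) s' < W"
            using k0 p3 i q_less n_less by (simp add: mult.commute)
          have "p ^ Suc k0 \<le> i \<and> i < p ^ Suc (Suc k0)"
            unfolding eq using p2 by simp
          then show "Q (wset 11 (wval (Lit 0) s') (wval (WMul (Var 11) (Var 3)) s') s')"
            using J k0 p3 unfolding Q_def J_def
            by (auto simp: mult.commute intro!: exI[of _ "Suc k0"])
        qed (use W in \<open>auto simp: adr_def\<close>)
      next
        fix s2 assume Q: "Q s2"
        then obtain k where k: "wget s2 11 0 = p ^ k" "p ^ k \<le> i" "i < p ^ Suc k"
          by (auto simp: Q_def)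
        have fr2: "frame {5, 9, 11} {} s s2" and i2: "wget s2 5 0 = i" and
          T: "\<And>v. v < i \<Longrightarrow> wget s2 9 v < q"
            "\<And>v j. v < i \<Longrightarrow> digit p j (wget s2 9 v) = (digit p j v + digit p j a) mod p"
          using Q by (auto simp: Q_def J_def)
        have p3: "wget s2 3 0 = p" using fr2 assms(2) by (simp add: frame_wget)
        let ?y = "incr_digit p (p ^ k) (wget s2 9 (i - p ^ k))"
        have less: "i - p ^ k < i" using k i(1) p2 by simp
        \<comment> \<open>The incremented position is below \<open>r\<close>, so the new entry stays
          below \<open>q = p ^ r\<close>.\<close>
        have "p ^ k < p ^ r" using k(2) i(2) q by linarith
        then have "k < r" using p2 by (simp add: power_less_imp_less_exp)
        then have y: "?y < q" using T(1)[OF less] incr_digit_less[OF p2, of _ r k] q by simp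
        have "digit p j ?y = (digit p j i + digit p j a) mod p" for j
          unfolding digit_incr_digit[OF p2] T(2)[OF less] digit_split_top[OF p2 k(2,3)]
            digit_power[OF p2] by (simp add: mod_simps ac_simps)
        with T y have *: "\<forall>v<Suc i. let z = (if v = i then ?y else wget s2 9 v) in
            z < q \<and> (\<forall>j. digit p j z = (digit p j v + digit p j a) mod p)"
          by (auto simp: less_Suc_eq)
        have "\<exists>k. wget s2 11 0 = p ^ k \<and> p ^ k \<le> Suc i \<and> Suc i \<le> p ^ Suc k"
          using k by (intro exI[of _ k]) auto
        with fr2 i2 p3 k(1) * show "runs W ?put s2 1
            (\<lambda>s'. wget s' 5 0 = i \<and> J (Suc i) (wset 5 0 (Suc i) s'))"
          using y q_less i n_less
          by (intro runs_Put) (auto simp: J_def Let_def split: if_splits intro!: adr_less)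
      qed
      then show "runs W (Seq ?step ?put) s' 3
          (\<lambda>s'. wget s' 5 0 = i \<and> J (Suc i) (wset 5 0 (Suc i) s'))"
        by (simp add: numeral_3_eq_3)
    qed (use W q_less q_pos assms s1 in \<open>auto simp: J_def frame_wget\<close>)
  qed
  then show ?thesis
    by (rule runs_mono) (use q_pos in \<open>auto simp: J_def algebra_simps\<close>)
qed

lemma runs_extend_table:
  assumes "wget s 0 0 = n" "wget s 3 0 = p" "wget s 4 0 = b" "b < n" "0 < b" "p \<le> q"
    and h: "\<And>u. u < b \<Longrightarrow> wget s 8 u < q" and T: "\<And>v. v < q \<Longrightarrow> wget s 9 v < q"
  shows "runs W extend_table s (3 * (min n (b * p) - b) + 5) (\<lambda>s'. frame {5, 8, 12} {} s s' \<and>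
    (\<forall>u<min n (b * p). wget s' 8 u < q) \<and> (\<forall>u<b. wget s' 8 u = wget s 8 u) \<and>
    (\<forall>u. b \<le> u \<longrightarrow> u < min n (b * p) \<longrightarrow> wget s' 8 u = wget s 9 (wget s' 8 (u - b))))"
proof -
  let ?l = "min n (b * p)"
  define J where "J i s' \<longleftrightarrow> frame {5, 8, 12} {} s s' \<and> wget s' 12 0 = ?l \<and>
    (\<forall>u<i. wget s' 8 u < q) \<and> (\<forall>u<b. wget s' 8 u = wget s 8 u) \<and>
    (\<forall>u. b \<le> u \<longrightarrow> u < i \<longrightarrow> wget s' 8 u = wget s 9 (wget s' 8 (u - b)))" for i s'
  have bp: "b * p < W"
  proof -
    have "b * p \<le> n * q" using assms by (intro mult_mono) auto
    then show ?thesis using W by simp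
  qed
  have b_le: "b \<le> ?l" using assms(4) p2 by simp
  have "runs W extend_table s (1 + (Suc 1 + ((?l - b) * (1 + 2) + 2))) (J ?l)"
    unfolding extend_table_def
  proof (intro runs_Seq)
    show "runs W (Assign 12 (WMul (Var 4) (Var 3))) s 1
        (\<lambda>s'. frame {5, 8, 12} {} s s' \<and> (\<forall>u. wget s' 8 u = wget s 8 u) \<and> wget s' 12 0 = b * p)"
      using W assms bp by (intro runs_Put) (auto simp: adr_def)
  next
    fix s1 assume s1: "frame {5, 8, 12} {} s s1 \<and> (\<forall>u. wget s1 8 u = wget s 8 u) \<and> wget s1 12 0 = b * p"
    then show "runs W (Cond (WLess (Var 0) (Var 12)) (Assign 12 (Var 0)) Skip) s1 (Suc 1)
        (\<lambda>s'. frame {5, 8, 12} {} s s' \<and> (\<forall>u. wget s' 8 u = wget s 8 u) \<and> wget s' 12 0 = ?l)"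
      using W assms n_less by (intro runs_Cond runs_Put runs_Skip) (auto simp: adr_def frame_wget)
  next
    fix s1 assume s1: "frame {5, 8, 12} {} s s1 \<and> (\<forall>u. wget s1 8 u = wget s 8 u) \<and> wget s1 12 0 = ?l"
    show "runs W (For (Var 4) (Var 12) (Put 8 (Var 5) (At 9 (At 8 (WSub (Var 5) (Var 4))))))
        s1 ((?l - b) * (1 + 2) + 2) (J ?l)"
    proof (rule runs_For)
      fix i s' assume i: "b \<le> i" "i < ?l" and J: "J i s'" "wget s' 5 0 = i"
      have fr: "frame {5, 8, 12} {} s s'" and l: "wget s' 12 0 = ?l"
        and less: "\<And>u. u < i \<Longrightarrow> wget s' 8 u < q" and old: "\<And>u. u < b \<Longrightarrow> wget s' 8 u = wget s 8 u"
        and new: "\<And>u. b \<le> u \<Longrightarrow> u < i \<Longrightarrow> wget s' 8 u = wget s 9 (wget s' 8 (u - b))"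
        using J(1) unfolding J_def by blast+
      have s': "wget s' 4 0 = b" "wget s' 9 v = wget s 9 v" for v
        using fr assms(3) by (simp_all add: frame_wget)
      let ?z = "wget s 9 (wget s' 8 (i - b))"
      have z: "?z < q" using i assms(5) by (intro T less) auto
      let ?s2 = "wset 5 0 (Suc i) (wset 8 i ?z s')"
      have "J (Suc i) ?s2"
        unfolding J_def
      proof (intro conjI allI impI)
        fix u assume u: "b \<le> u" "u < Suc i"
        \<comment> \<open>The entry referred to lies strictly below \<open>u\<close> as
          \<open>b > 0\<close>, so writing entry \<open>i\<close> does not change it.\<close>
        then have "u - b \<noteq> i" using assms(5) by auto
        then show "wget ?s2 8 u = wget s 9 (wget ?s2 8 (u - b))"
          using new[of u] u by (cases "u = i") (auto simp del: One_nat_def)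
      qed (use fr l less old z i in \<open>auto simp: less_Suc_eq\<close>)
      then show "runs W (Put 8 (Var 5) (At 9 (At 8 (WSub (Var 5) (Var 4))))) s' 1
          (\<lambda>s'. wget s' 5 0 = i \<and> J (Suc i) (wset 5 0 (Suc i) s'))"
        using J(2) s' i q_less n_less z by (intro runs_Put) (auto intro!: adr_less)
    next
      show "J b (wset 5 0 b s1)" using s1 h unfolding J_def by auto
    next
      fix i s' assume "J i s'"
      then have "wget s' 12 0 = ?l" unfolding J_def by blast
      then show "wval (Var 12) s' = ?l" by simp
    next
      show "?l < W" using n_less by simp
    qed (use W b_le s1 assms(3) in \<open>auto simp: frame_wget\<close>)
  qed
  then show ?thesis
    by (rule runs_mono) (simp, unfold J_def, blast)
qed

lemma runs_update_weights:
  assumes "wget s 4 0 = b" "b \<le> n" "wget s 6 0 = a" "rget s 1 0 = x" "\<And>j. wget s 10 j < m" "m < W"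
  shows "runs W update_weights s (5 * b + 2) (\<lambda>s'. frame {5, 10} {2} s s' \<and>
    (\<forall>j. wget s' 10 j = wget s 10 j + (if b \<le> j \<and> j < b + b \<and> wget s 8 (j - b) = a then 1 else 0)) \<and>
    (\<forall>j. rget s' 2 j = rget s 2 j * (if b \<le> j \<and> j < b + b \<and> wget s 8 (j - b) = a then x else 1)))"
proof -
  define J where "J i s' \<longleftrightarrow> frame {5, 10} {2} s s' \<and>
    (\<forall>j. wget s' 10 j = wget s 10 j + (if b \<le> j \<and> j < b + i \<and> wget s 8 (j - b) = a then 1 else 0)) \<and>
    (\<forall>j. rget s' 2 j = rget s 2 j * (if b \<le> j \<and> j < b + i \<and> wget s 8 (j - b) = a then x else 1))" for i s'
  let ?c = "Put 10 (WAdd (Var 4) (Var 5)) (WAdd (At 10 (WAdd (Var 4) (Var 5))) (Lit 1))"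
  let ?w = "RPut 2 (WAdd (Var 4) (Var 5)) (RMul (RAt 2 (WAdd (Var 4) (Var 5))) (RVar 1))"
  let ?t = "WLess (WAdd (WSub (At 8 (Var 5)) (Var 6)) (WSub (Var 6) (At 8 (Var 5)))) (Lit 1)"
  have "runs W update_weights s ((b - 0) * (Suc (1 + 1) + 2) + 2) (J b)"
    unfolding update_weights_def
  proof (rule runs_For)
    fix i s' assume i: "i < b" and J: "J i s'" "wget s' 5 0 = i"
    have fr: "frame {5, 10} {2} s s'" using J by (simp add: J_def)
    have s': "wget s' 4 0 = b" "wget s' 6 0 = a" "rget s' 1 0 = x" "wget s' 8 i = wget s 8 i"
        "wget s' 10 (b + i) = wget s 10 (b + i)"
      using fr J assms by (auto simp: frame_wget frame_rget J_def)
    have upto: "b \<le> j \<and> j < Suc (b + i) \<and> wget s 8 (j - b) = a \<longleftrightarrow>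
        (b \<le> j \<and> j < b + i \<and> wget s 8 (j - b) = a) \<or> (j = b + i \<and> wget s 8 i = a)" for j
      by (cases "j = b + i") auto
    show "runs W (Cond ?t (Seq ?c ?w) Skip) s' (Suc (1 + 1))
        (\<lambda>s'. wget s' 5 0 = i \<and> J (Suc i) (wset 5 0 (Suc i) s'))"
    proof (rule runs_Cond)
      assume "tval ?t s'"
      then have eq: "wget s 8 i = a" using s' J(2) by auto
      show "runs W (Seq ?c ?w) s' (1 + 1) (\<lambda>s'. wget s' 5 0 = i \<and> J (Suc i) (wset 5 0 (Suc i) s'))"
      proof (rule runs_Seq)
        show "runs W ?c s' 1 (\<lambda>s2. s2 = wset 10 (b + i) (wget s' 10 (b + i) + 1) s')"
          using s' J(2) i assms(2,6) assms(5)[of "b + i"] by (intro runs_Put) (auto intro!: adr_less)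
      next
        fix s2 assume "s2 = wset 10 (b + i) (wget s' 10 (b + i) + 1) s'"
        then show "runs W ?w s2 1 (\<lambda>s'. wget s' 5 0 = i \<and> J (Suc i) (wset 5 0 (Suc i) s'))"
          using s' J i assms(2) eq by (intro runs_RPut) (auto simp: J_def upto intro!: adr_less)
      qed
    next
      assume "\<not> tval ?t s'"
      then have "wget s 8 i \<noteq> a" using s' J(2) by auto
      then have "b \<le> j \<and> j < Suc (b + i) \<and> wget s 8 (j - b) = a \<longleftrightarrow>
          b \<le> j \<and> j < b + i \<and> wget s 8 (j - b) = a" for j
        using upto by blast
      then show "runs W Skip s' (1 + 1) (\<lambda>s'. wget s' 5 0 = i \<and> J (Suc i) (wset 5 0 (Suc i) s'))"
        using J by (intro runs_Skip) (simp add: J_def)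
    qed
  qed (use W q_less assms in \<open>auto simp: J_def frame_wget\<close>)
  then show ?thesis
    by (rule runs_mono) (auto simp: J_def)
qed

end

text \<open>Every number from \<open>b\<close> to below \<open>l <= b * p\<close> has leading power
  \<open>b\<close>, so there the filling rule is additivity itself, while below \<open>b\<close>
  nothing changes. The value at \<open>b\<close> is \<open>a\<close> because
  \<open>h' 0 = 0\<close>.\<close>

lemma digit_additive_extend:
  assumes p: "p \<ge> 2" and b: "b = p ^ k" "l \<le> b * p" "b < l"
    and h: "digit_additive p b h" and agree: "\<And>u. u < b \<Longrightarrow> h' u = h u"
    and new: "\<And>u j. b \<le> u \<Longrightarrow> u < l \<Longrightarrow>
      digit p j (h' u) = (digit p j (h' (u - b)) + digit p j a) mod p"
  shows "h' b = a" "digit_additive p l h'"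
proof -
  have b0: "b > 0" using b(1) p by simp
  have h0: "h' 0 = 0" using agree[OF b0] h by (simp add: digit_additive_def)
  show hb: "h' b = a"
  proof (rule digit_ext[OF p])
    fix j
    have "digit p j (h' b) = (digit p j (h' 0) + digit p j a) mod p"
      using new[of b j] b by simp
    then show "digit p j (h' b) = digit p j a" using h0 by (simp add: digit_def)
  qed
  have "digit p j (h' x) = (digit p j (h' (x - p ^ i)) + digit p j (h' (p ^ i))) mod p"
    if x: "p ^ i \<le> x" "x < p ^ Suc i" "x < l" for i x j
  proof (cases "x < b")
    case True
    then have "h' x = h x" "h' (x - p ^ i) = h (x - p ^ i)" "h' (p ^ i) = h (p ^ i)"
      using x by (auto intro!: agree)
    then show ?thesis
      using h x True unfolding digit_additive_def by metis
  next
    case False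
    have "p ^ i < p ^ Suc k" "p ^ k < p ^ Suc i"
      using x False b by (auto simp: mult.commute)
    then have "i = k" using p by (simp only: power_less_imp_less_exp power_strict_increasing_iff)
    then show ?thesis using new[of x j] hb False x(3) b(1) by simp
  qed
  with h0 show "digit_additive p l h'" by (simp add: digit_additive_def)
qed

lemma digit_additive_id:
  assumes "p \<ge> 2" "\<And>u. u < q \<Longrightarrow> h u = u" "q > 0"
  shows "digit_additive p q h"
proof -
  have "digit_additive p q (\<lambda>u. u)"
    using digit_split_top[OF assms(1)] by (simp add: digit_additive_def)
  then show ?thesis using assms(2,3) by (intro digit_additive_cong[of q "\<lambda>u. u" h]) auto
qed

text \<open>The data of \<open>(b, u)\<close> is stored at \<open>b + u\<close>, hence level
  \<open>b\<close> occupies the block from \<open>b\<close> to below \<open>2 * b\<close>. Blocks of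
  different powers do not overlap as \<open>p >= 2\<close>.\<close>

lemma levels_disjoint:
  assumes "p \<ge> 2" "b \<in> levels p q n" "b' \<in> levels p q n"
    and "b \<le> j" "j < b + b" "b' \<le> j" "j < b' + b'"
  shows "b = b'"
proof -
  obtain k k' where k: "b = p ^ k" "b' = p ^ k'" using assms by (auto simp: levels_def)
  have "2 * p ^ k \<le> p ^ Suc k" "2 * p ^ k' \<le> p ^ Suc k'" using assms(1) by auto
  then have "p ^ k < p ^ Suc k'" "p ^ k' < p ^ Suc k" using assms k by linarith+
  then have "k = k'" using assms(1) by (simp only: power_strict_increasing_iff)
  then show ?thesis using k by simp
qed

section \<open>Invariants of a round and the processing of one level\<close>

definition process_level :: prog where
  "process_level = Seq clear_buckets (Seq fill_buckets (Seq choose_value (Seq tabulate_addition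
     (Seq extend_table (Seq update_weights (Assign 4 (WMul (Var 4) (Var 3))))))))"

locale greedy_hashing = digit_hashing +
  fixes d :: nat and \<epsilon> x :: real
  assumes d_pos: "d > 0" and eps_pos: "\<epsilon> > 0" and r_pos: "r > 0"
    and x: "x = \<epsilon> * real q / pairs_plus_one d" and x_gt_1: "x > 1"
begin

definition parameters :: "nat \<Rightarrow> store \<Rightarrow> bool" where
  "parameters t s \<longleftrightarrow> wget s 0 0 = n \<and> wget s 1 0 = q \<and> wget s 2 0 = d \<and> wget s 3 0 = p \<and>
     wget s 7 0 = t \<and> rget s 0 0 = \<epsilon> \<and> rget s 1 0 = x"

text \<open>The list of counted functions may vary with the level, since during a round only the
  levels already processed include the new function. Cells outside all blocks are kept at 0, so that
  the balance check can scan the array without knowing the levels.\<close>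

definition recorded :: "(nat \<Rightarrow> (nat \<Rightarrow> nat) list) \<Rightarrow> store \<Rightarrow> bool" where
  "recorded F s \<longleftrightarrow>
     (\<forall>b\<in>levels p q n. \<forall>u<b. wget s 10 (b + u) = collisions (F b) b u \<and>
        rget s 2 (b + u) = x ^ collisions (F b) b u) \<and>
     (\<forall>j. (\<forall>b\<in>levels p q n. \<not> (b \<le> j \<and> j < b + b)) \<longrightarrow> wget s 10 j = 0)"

text \<open>The table is constrained only below the current power, which may exceed \<open>n\<close>
  in the end. Appending it to \<open>H\<close> is meaningful for the levels \<open>b\<close> already
  processed, as collisions of \<open>(b, u)\<close> depend only on the values at \<open>b\<close>
  and \<open>u\<close>.\<close>

definition level_inv :: "(nat \<Rightarrow> nat) list \<Rightarrow> store \<Rightarrow> bool" where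
  "level_inv H s \<longleftrightarrow> parameters (length H) s \<and> outp s = family_table n H \<and>
     (\<exists>k. wget s 4 0 = p ^ k) \<and> q \<le> wget s 4 0 \<and>
     (\<forall>u<min n (wget s 4 0). wget s 8 u < q) \<and> (\<forall>u<q. wget s 8 u = u) \<and>
     digit_additive p (min n (wget s 4 0)) (wget s 8) \<and>
     (\<forall>b\<in>levels p q n. b < wget s 4 0 \<longrightarrow> greedy_choice q x H (wget s 8) b) \<and>
     recorded (\<lambda>b. if b < wget s 4 0 then H @ [wget s 8] else H) s"

text \<open>Counters never exceed the number of counted functions, which keeps them within the word
  bound.\<close>

lemma recorded_bound:
  assumes "recorded F s" "\<And>b. length (F b) < m"
  shows "wget s 10 j < m"
proof (cases "\<exists>b\<in>levels p q n. b \<le> j \<and> j < b + b")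
  case True
  then obtain b where b: "b \<in> levels p q n" "b \<le> j" "j < b + b" by blast
  moreover from this have "j - b < b" by linarith
  ultimately have "wget s 10 (b + (j - b)) = collisions (F b) b (j - b)"
    using assms(1) unfolding recorded_def by blast
  then show ?thesis
    using b assms(2)[of b] collisions_le[of "F b" b "j - b"] by simp
next
  case False
  then show ?thesis using assms(2)[of undefined] assms(1) by (auto simp: recorded_def)
qed

text \<open>At level \<open>b\<close> one more function is counted. At the other levels the list may
  change as long as the collisions agree, since the extended table takes the place of the shorter
  one. Their cells are untouched because blocks are disjoint.\<close>

lemma recorded_update:
  assumes F: "recorded F s" and b: "b \<in> levels p q n" "F b = H" and F': "F' b = H @ [h]"
    "\<And>b'. b' \<in> levels p q n \<Longrightarrow> b' \<noteq> b \<Longrightarrow>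
      \<forall>u<b'. collisions (F' b') b' u = collisions (F b') b' u"
    and c: "\<And>j. wget s' 10 j = wget s 10 j + (if b \<le> j \<and> j < b + b \<and> h (j - b) = h b then 1 else 0)"
    and w: "\<And>j. rget s' 2 j = rget s 2 j * (if b \<le> j \<and> j < b + b \<and> h (j - b) = h b then x else 1)"
  shows "recorded F' s'"
  unfolding recorded_def
proof (intro conjI ballI allI impI)
  fix b' u assume b': "b' \<in> levels p q n" "u < b'"
  have old: "wget s 10 (b' + u) = collisions (F b') b' u" "rget s 2 (b' + u) = x ^ collisions (F b') b' u"
    using F b' by (auto simp: recorded_def)
  show "wget s' 10 (b' + u) = collisions (F' b') b' u"
    "rget s' 2 (b' + u) = x ^ collisions (F' b') b' u"
  proof (atomize (full), cases "b' = b")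
    case True
    then show "wget s' 10 (b' + u) = collisions (F' b') b' u \<and>
        rget s' 2 (b' + u) = x ^ collisions (F' b') b' u"
      using old b' b(2) F'(1) c[of "b + u"] w[of "b + u"] by auto
  next
    case False
    then have "\<not> (b \<le> b' + u \<and> b' + u < b + b)"
      using levels_disjoint[OF p2 b(1) b'(1), of "b' + u"] b'(2) by auto
    then show "wget s' 10 (b' + u) = collisions (F' b') b' u \<and>
        rget s' 2 (b' + u) = x ^ collisions (F' b') b' u"
      using old F'(2)[OF b'(1) False] b'(2) c[of "b' + u"] w[of "b' + u"] by auto
  qed
next
  fix j assume "\<forall>b\<in>levels p q n. \<not> (b \<le> j \<and> j < b + b)"
  then show "wget s' 10 j = 0" using F b(1) c[of j] unfolding recorded_def by auto
qed

end

locale bounded_greedy_hashing = greedy_hashing + word_bounds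
begin

lemma runs_process_level:
  assumes inv: "level_inv H s" and b: "wget s 4 0 = b" "b < n" and t: "length H + 2 < W"
  shows "runs W process_level s (20 * b + 3 * (min n (b * p) - b) + 20)
    (\<lambda>s'. level_inv H s' \<and> wget s' 4 0 = b * p)"
proof -
  let ?l = "min n (b * p)" and ?h = "wget s 8"
  obtain k where k: "b = p ^ k" using inv b by (auto simp: level_inv_def)
  have qb: "q \<le> b" and out: "outp s = family_table n H" and par: "parameters (length H) s"
    and h: "\<And>u. u < b \<Longrightarrow> ?h u < q" "\<And>u. u < q \<Longrightarrow> ?h u = u" "digit_additive p b ?h"
    and greedy: "\<And>b'. b' \<in> levels p q n \<Longrightarrow> b' < b \<Longrightarrow> greedy_choice q x H ?h b'"
    and rec: "recorded (\<lambda>b'. if b' < b then H @ [?h] else H) s"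
    using inv b unfolding level_inv_def by (auto simp: min_def)
  have b_level: "b \<in> levels p q n" using k qb b(2) by (auto simp: levels_def)
  have b0: "b > 0" using qb q_pos by simp
  have bp: "b < b * p" using b0 p2 by simp
  have p_le: "p \<le> q" using q r_pos p2 by (simp add: self_le_power)
  have par': "wget s 0 0 = n" "wget s 1 0 = q" "wget s 2 0 = d" "wget s 3 0 = p"
    "wget s 7 0 = length H" "rget s 0 0 = \<epsilon>" "rget s 1 0 = x"
    using par by (auto simp: parameters_def)
  have "runs W process_level s ((3 * q + 2) + ((3 * b + 2) + ((4 * q + 3) + ((5 * q + 4) +
      ((3 * (?l - b) + 5) + ((5 * b + 2) + 1)))))) (\<lambda>s'. level_inv H s' \<and> wget s' 4 0 = b * p)"
    unfolding process_level_def
  proof (rule runs_Seq[OF runs_clear_buckets])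
    fix s1 assume s1: "frame {5} {3} s s1 \<and> (\<forall>v<q. rget s1 3 v = 0)"
    note f1 = s1[THEN conjunct1]
    show "runs W (Seq fill_buckets (Seq choose_value (Seq tabulate_addition
     (Seq extend_table (Seq update_weights (Assign 4 (WMul (Var 4) (Var 3)))))))) s1
       ((3 * b + 2) + ((4 * q + 3) + ((5 * q + 4) +
      ((3 * (?l - b) + 5) + ((5 * b + 2) + 1))))) (\<lambda>s'. level_inv H s' \<and> wget s' 4 0 = b * p)"
    proof (rule runs_Seq[OF runs_fill_buckets])
      fix s2 assume s2: "frame {5} {3} s1 s2 \<and> (\<forall>v. rget s2 3 v =
        rget s1 3 v + (\<Sum>u<b. if wget s1 8 u = v then rget s1 2 (b + u) else 0))"
      note f2 = frame_trans[OF f1 s2[THEN conjunct1]]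
      \<comment> \<open>At level \<open>b\<close> itself the record still refers to \<open>H\<close>
        alone, as \<open>b < b\<close> fails.\<close>
      have bucket: "rget s2 3 v = (\<Sum>u<b. if ?h u = v then x ^ collisions H b u else 0)" if "v < q" for v
        using s1 s2 that rec b_level
        by (auto simp: frame_wget[OF f1] frame_rget[OF f1] recorded_def intro!: sum.cong)
      show "runs W (Seq choose_value (Seq tabulate_addition
         (Seq extend_table (Seq update_weights (Assign 4 (WMul (Var 4) (Var 3))))))) s2
         ((4 * q + 3) + ((5 * q + 4) +
          ((3 * (?l - b) + 5) + ((5 * b + 2) + 1)))) (\<lambda>s'. level_inv H s' \<and> wget s' 4 0 = b * p)"
      proof (rule runs_Seq[OF runs_choose_value])
        fix s3 assume s3: "frame {5, 6} {} s2 s3 \<and> wget s3 6 0 < q \<and>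
          (\<forall>v<q. rget s3 3 (wget s3 6 0) \<le> rget s3 3 v)"
        note f3 = frame_trans[OF f2 s3[THEN conjunct1]]
        define a where "a = wget s3 6 0"
        have a: "a < q" using s3 by (simp add: a_def)
        \<comment> \<open>The least of the \<open>q\<close> buckets is at most their average, and
          together they hold the whole weight since every \<open>?h u\<close> is below
          \<open>q\<close>.\<close>
        have "real q * (\<Sum>u<b. if ?h u = a then x ^ collisions H b u else 0)
            = (\<Sum>v<q. rget s2 3 a)" using bucket[OF a] by simp
        also have "\<dots> \<le> (\<Sum>v<q. rget s2 3 v)"
          using s3 by (intro sum_mono) (auto simp: a_def frame_rget[OF s3[THEN conjunct1]])
        also have "\<dots> = (\<Sum>v<q. \<Sum>u<b. if ?h u = v then x ^ collisions H b u else 0)"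
          by (intro sum.cong) (auto simp: bucket)
        also have "\<dots> = (\<Sum>u<b. \<Sum>v<q. if ?h u = v then x ^ collisions H b u else 0)"
          by (rule sum.swap)
        also have "\<dots> = (\<Sum>u<b. x ^ collisions H b u)"
          using h(1) by (intro sum.cong) (auto simp: sum.delta')
        finally have a_min: "real q * (\<Sum>u<b. if ?h u = a then x ^ collisions H b u else 0)
          \<le> (\<Sum>u<b. x ^ collisions H b u)" .
        show "runs W (Seq tabulate_addition
           (Seq extend_table (Seq update_weights (Assign 4 (WMul (Var 4) (Var 3)))))) s3
           ((5 * q + 4) +
            ((3 * (?l - b) + 5) + ((5 * b + 2) + 1))) (\<lambda>s'. level_inv H s' \<and> wget s' 4 0 = b * p)"
        proof (rule runs_Seq[OF runs_tabulate_addition])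
          fix s4 assume s4: "frame {5, 9, 11} {} s3 s4 \<and> (\<forall>v<q. wget s4 9 v < q \<and>
            (\<forall>j. digit p j (wget s4 9 v) = (digit p j v + digit p j a) mod p))"
          note f4 = frame_trans[OF f3 s4[THEN conjunct1]]
          show "runs W (Seq extend_table (Seq update_weights (Assign 4 (WMul (Var 4) (Var 3))))) s4
             ((3 * (?l - b) + 5) + ((5 * b + 2) + 1)) (\<lambda>s'. level_inv H s' \<and> wget s' 4 0 = b * p)"
          proof (rule runs_Seq[OF runs_extend_table])
            fix s5 assume s5: "frame {5, 8, 12} {} s4 s5 \<and> (\<forall>u<?l. wget s5 8 u < q) \<and>
              (\<forall>u<b. wget s5 8 u = wget s4 8 u) \<and>
              (\<forall>u. b \<le> u \<longrightarrow> u < ?l \<longrightarrow> wget s5 8 u = wget s4 9 (wget s5 8 (u - b)))"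
            note f5 = frame_trans[OF f4 s5[THEN conjunct1]]
            define h' where "h' = wget s5 8"
            have h'_less: "\<And>u. u < ?l \<Longrightarrow> h' u < q" and h'_old: "\<And>u. u < b \<Longrightarrow> h' u = ?h u"
              and h'_new: "\<And>u. b \<le> u \<Longrightarrow> u < ?l \<Longrightarrow> h' u = wget s4 9 (h' (u - b))"
              using s5 by (simp_all add: h'_def frame_wget[OF f4])
            have l: "?l \<le> b * p" "b < ?l" using bp b(2) by auto
            have dig: "digit p j (h' u) = (digit p j (h' (u - b)) + digit p j a) mod p"
              if "b \<le> u" "u < ?l" for u j
            proof -
              have "h' (u - b) < q" using that b0 by (intro h'_less) auto
              then show ?thesis using s4 h'_new[OF that] by simp
            qed
            note h'b = digit_additive_extend(1)[OF p2 k l h(3) h'_old dig]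
              and add = digit_additive_extend(2)[OF p2 k l h(3) h'_old dig]
            have h'_id: "h' u = u" if "u < q" for u using that h'_old h(2) qb by simp
            have s5v: "wget s5 8 u = h' u" for u by (simp add: h'_def)
            have a5: "wget s5 6 0 = a"
              using frame_wget[OF s5[THEN conjunct1], of 6 0] frame_wget[OF s4[THEN conjunct1], of 6 0]
              by (simp add: a_def)
            have c5: "wget s5 10 j < length H + 2" for j
              using recorded_bound[OF rec, of "length H + 2"] by (simp add: frame_wget[OF f5])
            show "runs W (Seq update_weights (Assign 4 (WMul (Var 4) (Var 3)))) s5 ((5 * b + 2) + 1)
              (\<lambda>s'. level_inv H s' \<and> wget s' 4 0 = b * p)"
            proof (rule runs_Seq[OF runs_update_weights[OF _ _ a5 _ c5 t]])
              fix s6 assume s6: "frame {5, 10} {2} s5 s6 \<and>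
                (\<forall>j. wget s6 10 j = wget s5 10 j + (if b \<le> j \<and> j < b + b \<and> wget s5 8 (j - b) = a then 1 else 0)) \<and>
                (\<forall>j. rget s6 2 j = rget s5 2 j * (if b \<le> j \<and> j < b + b \<and> wget s5 8 (j - b) = a then x else 1))"
              note f6 = frame_trans[OF f5 s6[THEN conjunct1]]
              let ?s7 = "wset 4 0 (b * p) s6"
              have h6: "wget s6 8 = h'"
                using frame_wget[OF s6[THEN conjunct1], of 8] by (auto simp: h'_def)
              have coll: "collisions (H @ [h']) b' u = collisions (H @ [?h]) b' u"
                if "u < b'" "b' < b" for b' u
                using that h'_old by simp
              \<comment> \<open>No power of \<open>p\<close> lies strictly between \<open>b\<close>
                and \<open>b * p\<close>.\<close>
              have lev: "b' < b * p \<longleftrightarrow> b' < b \<or> b' = b" if b': "b' \<in> levels p q n" for b'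
              proof -
                obtain k' where k': "b' = p ^ k'" using b' by (auto simp: levels_def)
                have "b' < p ^ Suc k \<longleftrightarrow> k' < Suc k" "b' < b \<longleftrightarrow> k' < k" "b' = b \<longleftrightarrow> k' = k"
                  using p2 unfolding k k' by (auto simp only: power_strict_increasing_iff power_inject_exp)
                then show ?thesis using k by (auto simp: mult.commute)
              qed
              have "recorded (\<lambda>b'. if b' < b * p then H @ [h'] else H) s6"
              proof (rule recorded_update[OF rec b_level])
                fix b' assume "b' \<in> levels p q n" "b' \<noteq> b"
                then show "\<forall>u<b'. collisions (if b' < b * p then H @ [h'] else H) b' u
                  = collisions (if b' < b then H @ [?h] else H) b' u"
                  using lev[of b'] coll by auto
              qed (use s6 bp h'b in \<open>auto simp: s5v frame_wget[OF f5] frame_rget[OF f5]\<close>)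
              then have rec': "recorded (\<lambda>b'. if b' < b * p then H @ [h'] else H) ?s7"
                by (simp add: recorded_def)
              have greedy': "greedy_choice q x H h' b'" if "b' \<in> levels p q n" "b' < b * p" for b'
              proof (cases "b' = b")
                case True
                have "(\<Sum>u<b. if h' b = h' u then x ^ collisions H b u else 0)
                  = (\<Sum>u<b. if ?h u = a then x ^ collisions H b u else 0)"
                  using h'b h'_old by (intro sum.cong) auto
                then show ?thesis using a_min True by (simp add: greedy_choice_def)
              next
                case False
                then have b': "b' < b" using lev that by blast
                then have "(\<Sum>u<b'. if h' b' = h' u then x ^ collisions H b' u else 0)
                  = (\<Sum>u<b'. if ?h b' = ?h u then x ^ collisions H b' u else 0)"
                  using h'_old by (intro sum.cong) auto
                then show ?thesis using greedy[OF that(1) b'] by (simp add: greedy_choice_def)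
              qed
              have par7: "parameters (length H) ?s7"
                using par' by (simp add: parameters_def frame_wget[OF f6] frame_rget[OF f6])
              have out7: "outp ?s7 = family_table n H"
                using out by (simp add: frame_outp[OF f6])
              have pow: "\<exists>k. b * p = p ^ k" using k by (intro exI[of _ "Suc k"]) simp
              have q_le: "q \<le> b * p" using qb bp by linarith
              have b7: "wget ?s7 4 0 = b * p" and h7: "wget ?s7 8 = h'" using h6 by auto
              have "level_inv H ?s7"
                unfolding level_inv_def b7 h7
                using par7 out7 pow q_le h'_less h'_id add greedy' rec' by blast
              then show "runs W (Assign 4 (WMul (Var 4) (Var 3))) s6 1
                (\<lambda>s'. level_inv H s' \<and> wget s' 4 0 = b * p)"
              proof (intro runs_Put)
                have "b * p \<le> n * q" using b p_le by (intro mult_mono) auto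
                then have "b * p < W" using W by simp
                then show "wval (WMul (Var 4) (Var 3)) s6 < W"
                  using par' b by (simp add: frame_wget[OF f6])
              qed (use W par' b in \<open>auto simp: adr_def frame_wget[OF f6]\<close>)
            qed (use par' b in \<open>auto simp: frame_wget[OF f5] frame_rget[OF f5]\<close>)
          qed (use par' b b0 p_le h s4 in \<open>auto simp: frame_wget[OF f4]\<close>)
        qed (use par' a in \<open>auto simp: frame_wget[OF f3] a_def\<close>)
      qed (use par' in \<open>auto simp: frame_wget[OF f2]\<close>)
    qed (use b h in \<open>auto simp: frame_wget[OF f1]\<close>)
  qed (use par' in auto)
  \<comment> \<open>Clearing, choosing and tabulating cost \<open>12 * q\<close> steps up to
    constants; \<open>q <= b\<close> charges them to the level.\<close>
  then show ?thesis by (rule runs_mono) (use qb in auto)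
qed

end

section \<open>The complete program\<close>

definition print_table :: prog where
  "print_table = For (Lit 0) (Var 0) (Out (At 8 (Var 5)))"

text \<open>For a counter \<open>c\<close> after \<open>t\<close> functions, the flag is raised if
  \<open>c <= \<epsilon> * t / pairs_plus_one d\<close> fails; both sides are multiplied by
  \<open>2 * pairs_plus_one d = d * (d - 1) + 2\<close>.\<close>

definition check_balance :: prog where
  "check_balance = For (Lit 0) (WMul (Lit 2) (Var 0))
     (Cond (RLess (RMul (OfWord (Lit 2)) (RMul (RVar 0) (OfWord (Var 7))))
        (OfWord (WMul (At 10 (Var 5)) (WAdd (WMul (Var 2) (WSub (Var 2) (Lit 1))) (Lit 2)))))
       (Assign 13 (Lit 1)) Skip)"

definition greedy_round :: prog where
  "greedy_round = Seq (Assign 4 (Var 1)) (Seq (Loop (WLess (Var 4) (Var 0)) process_level)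
     (Seq (Assign 7 (WAdd (Var 7) (Lit 1))) (Seq (Assign 13 (Lit 0))
       (Seq print_table check_balance))))"

text \<open>The prime \<open>p\<close> is found by trial as the least divisor of \<open>q\<close>
  above 1, which is affordable because \<open>q < n\<close> whenever this part runs.\<close>

definition prepare :: prog where
  "prepare = Seq (Assign 3 (Lit 2))
     (Seq (Loop (WLess (Lit 0) (WMod (Var 1) (Var 3))) (Assign 3 (WAdd (Var 3) (Lit 1))))
     (Seq (RAssign 1 (RDiv (RMul (RMul (OfWord (Lit 2)) (RVar 0)) (OfWord (Var 1)))
        (OfWord (WAdd (WMul (Var 2) (WSub (Var 2) (Lit 1))) (Lit 2)))))
     (Seq (For (Lit 0) (Var 1) (Put 8 (Var 5) (Var 5)))
     (Seq (For (Lit 0) (WMul (Lit 2) (Var 0)) (RPut 2 (Var 5) (OfWord (Lit 1))))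
       (Assign 13 (Lit 1))))))"

definition dense_phf_program :: prog where
  "dense_phf_program = Cond (WLess (Var 1) (Var 0))
     (Cond (RLess (RVar 0) (OfWord (Lit 1)))
        (Seq prepare (Loop (WLess (Lit 0) (Var 13)) greedy_round))
        (For (Lit 0) (Var 0) (Out (Lit 0))))
     (For (Lit 0) (Var 0) (Out (Var 5)))"

lemma family_table_snoc: "family_table n (H @ [h]) = family_table n H @ map h [0..<n]"
  by (simp add: family_table_def)

lemma two_pairs_plus_one: "d > 0 \<Longrightarrow> real (d * (d - 1) + 2) = 2 * pairs_plus_one d"
  by (cases d) (simp_all add: pairs_plus_one_def algebra_simps)

text \<open>\<open>frame\<close> includes equality of outputs, so the new output is put into the
  initial store before comparing.\<close>

lemma runs_print:
  assumes W: "16 \<le> W" "n < W" and n: "wget s 0 0 = n"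
    and e: "\<And>i s'. i < n \<Longrightarrow> frame {5} {} (s\<lparr>outp := outp s'\<rparr>) s' \<Longrightarrow> wget s' 5 0 = i \<Longrightarrow> wval e s' = f i"
    and f: "\<And>i. i < n \<Longrightarrow> f i < W"
  shows "runs W (For (Lit 0) (Var 0) (Out e)) s (3 * n + 2) (\<lambda>s'.
    frame {5} {} (s\<lparr>outp := outp s'\<rparr>) s' \<and> outp s' = outp s @ map f [0..<n])"
proof -
  define J where "J i s' \<longleftrightarrow> frame {5} {} (s\<lparr>outp := outp s'\<rparr>) s' \<and> outp s' = outp s @ map f [0..<i]"
    for i s'
  have "runs W (For (Lit 0) (Var 0) (Out e)) s ((n - 0) * (1 + 2) + 2) (J n)"
  proof (rule runs_For)
    fix i s' assume i: "i < n" and J: "J i s'" "wget s' 5 0 = i"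
    then have "wval e s' = f i" using e[of i s'] unfolding J_def by blast
    then show "runs W (Out e) s' 1 (\<lambda>s'. wget s' 5 0 = i \<and> J (Suc i) (wset 5 0 (Suc i) s'))"
      using J f[OF i] by (intro runs_Out) (auto simp: J_def frame_def)
  next
    fix i s' assume "J i s'"
    then show "wval (Var 0) s' = n" using n by (auto simp: J_def frame_wget)
  qed (use W in \<open>auto simp: J_def frame_def\<close>)
  then show ?thesis by (rule runs_mono) (auto simp: J_def)
qed

context greedy_hashing
begin

text \<open>The flag forces a first round on the empty list, which is vacuously balanced but not an
  admissible family.\<close>

definition main_inv :: "(nat \<Rightarrow> nat) list \<Rightarrow> store \<Rightarrow> bool" where
  "main_inv H s \<longleftrightarrow> parameters (length H) s \<and> outp s = family_table n H \<and> (\<forall>u<q. wget s 8 u = u) \<and>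
     (\<forall>h\<in>set H. hash_function p q n h) \<and>
     potential p q n x H \<le> real n ^ 2 * (1 + (x - 1) / real q) ^ length H \<and>
     recorded (\<lambda>_. H) s \<and>
     wget s 13 0 = (if H = [] \<or> \<not> balanced p q n (x / real q) H then 1 else 0)"

text \<open>Since \<open>x / q = \<epsilon> / pairs_plus_one d\<close>, the two inequalities differ
  by the factor \<open>2 * pairs_plus_one d\<close>. Cells outside the blocks contain 0 and pass the
  test.\<close>

lemma balanced_iff_recorded:
  assumes "recorded (\<lambda>_. H) s"
  shows "balanced p q n (x / real q) H \<longleftrightarrow>
    (\<forall>j<2 * n. \<not> 2 * (\<epsilon> * real (length H)) < real (wget s 10 j * (d * (d - 1) + 2)))"
proof -
  have P: "pairs_plus_one d > 0" by (rule pairs_plus_one_pos)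
  have iff: "real c \<le> x / real q * real (length H) \<longleftrightarrow>
      \<not> 2 * (\<epsilon> * real (length H)) < real (c * (d * (d - 1) + 2))" for c
    unfolding of_nat_mult[of c] two_pairs_plus_one[OF d_pos]
    using P q_pos by (simp add: x field_simps not_less)
  show ?thesis
  proof
    assume bal: "balanced p q n (x / real q) H"
    show "\<forall>j<2 * n. \<not> 2 * (\<epsilon> * real (length H)) < real (wget s 10 j * (d * (d - 1) + 2))"
    proof (intro allI impI)
      fix j assume "j < 2 * n"
      show "\<not> 2 * (\<epsilon> * real (length H)) < real (wget s 10 j * (d * (d - 1) + 2))"
      proof (cases "\<exists>b\<in>levels p q n. b \<le> j \<and> j < b + b")
        case True
        then obtain b where b: "b \<in> levels p q n" "b \<le> j" "j - b < b" by fastforce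
        then have "wget s 10 (b + (j - b)) = collisions H b (j - b)"
          using assms unfolding recorded_def by blast
        then show ?thesis using b bal iff by (simp add: balanced_def)
      next
        case False
        then have "wget s 10 j = 0" using assms by (auto simp: recorded_def)
        then show ?thesis using eps_pos by (simp add: not_less)
      qed
    qed
  next
    assume *: "\<forall>j<2 * n. \<not> 2 * (\<epsilon> * real (length H)) < real (wget s 10 j * (d * (d - 1) + 2))"
    show "balanced p q n (x / real q) H"
      unfolding balanced_def
    proof (intro ballI allI impI)
      fix b u assume b: "b \<in> levels p q n" "u < b"
      then have "b + u < 2 * n" by (auto simp: levels_def)
      moreover have "wget s 10 (b + u) = collisions H b u"
        using assms b unfolding recorded_def by blast
      ultimately show "real (collisions H b u) \<le> x / real q * real (length H)"
        using * unfolding iff by metis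
    qed
  qed
qed

end

section \<open>Correctness and cost of a round and of the preparation\<close>

context bounded_greedy_hashing
begin

lemma runs_levels:
  assumes inv: "level_inv H s" and b: "wget s 4 0 = q" and t: "length H + 2 < W"
  shows "runs W (Loop (WLess (Var 4) (Var 0)) process_level) s (80 * n)
    (\<lambda>s'. level_inv H s' \<and> n \<le> wget s' 4 0)"
proof -
  \<comment> \<open>If the next power \<open>c >= 2 * b\<close> is below \<open>n\<close>, the
    budget drops by \<open>40 * (c - b)\<close>, which exceeds the cost of the level since
    \<open>b >= 2\<close>. At the last level more than \<open>40 * n\<close> is left, which
    suffices.\<close>
  define f where "f s = (let b = wget s 4 0 in if b < n then 40 * (2 * n - b) else 0)" for s
  have n0: "wget s 0 0 = n" if "level_inv H s" for s
    using that by (simp add: level_inv_def parameters_def)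
  have "runs W (Loop (WLess (Var 4) (Var 0)) process_level) s (f s + 1)
      (\<lambda>s'. level_inv H s' \<and> \<not> tval (WLess (Var 4) (Var 0)) s')"
  proof (rule runs_Loop[where I = "level_inv H"])
    show "level_inv H s" by (rule inv)
  next
    fix s1 assume s1: "level_inv H s1" "tval (WLess (Var 4) (Var 0)) s1"
    define b where "b = wget s1 4 0"
    have bn: "b < n" using s1 n0 by (simp add: b_def)
    have qb: "q \<le> b" using s1(1) by (simp add: level_inv_def b_def)
    have "p ^ 1 \<le> p ^ r" using r_pos p2 by (intro power_increasing) auto
    then have b2: "b \<ge> 2" using qb p2 q by simp
    have "runs W process_level s1 (20 * b + 3 * (min n (b * p) - b) + 20)
        (\<lambda>s'. level_inv H s' \<and> 20 * b + 3 * (min n (b * p) - b) + 20 + f s' < f s1)"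
    proof (rule runs_mono[OF runs_process_level[OF s1(1) b_def[symmetric] bn t]])
      fix s2 assume s2: "level_inv H s2 \<and> wget s2 4 0 = b * p"
      have "20 * b + 3 * (min n (b * p) - b) + 20 + f s2 < f s1"
      proof (cases "b * p < n")
        case True
        define c where "c = b * p"
        have "c \<ge> b * 2" unfolding c_def using p2 by (intro mult_left_mono) auto
        then show ?thesis
          using True bn b2 s2 unfolding c_def[symmetric] by (simp add: f_def b_def[symmetric])
      next
        case False
        then show ?thesis using bn b2 s2 by (simp add: f_def Let_def b_def[symmetric])
      qed
      then show "level_inv H s2 \<and> 20 * b + 3 * (min n (b * p) - b) + 20 + f s2 < f s1"
        using s2 by blast
    qed simp
    then show "\<exists>\<tau>. runs W process_level s1 \<tau> (\<lambda>s'. level_inv H s' \<and> \<tau> + f s' < f s1)" by blast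
  qed
  then show ?thesis
  proof (rule runs_mono)
    show "f s + 1 \<le> 80 * n" using q_pos q_less b by (simp add: f_def)
  qed (use n0 in auto)
qed

lemma runs_check_balance:
  assumes "parameters t s" "wget s 13 0 = 0"
  shows "runs W check_balance s (8 * n + 2) (\<lambda>s'. frame {5, 13} {} s s' \<and> wget s' 13 0 =
    (if \<forall>j<2 * n. \<not> 2 * (\<epsilon> * real t) < real (wget s 10 j * (d * (d - 1) + 2)) then 0 else 1))"
proof -
  define bad where "bad j \<longleftrightarrow> 2 * (\<epsilon> * real t) < real (wget s 10 j * (d * (d - 1) + 2))" for j
  define J where "J i s' \<longleftrightarrow> frame {5, 13} {} s s' \<and> wget s' 13 0 = (if \<forall>j<i. \<not> bad j then 0 else 1)"
    for i s'
  have par: "wget s 0 0 = n" "wget s 2 0 = d" "wget s 7 0 = t" "rget s 0 0 = \<epsilon>"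
    using assms(1) by (auto simp: parameters_def)
  let ?t = "RLess (RMul (OfWord (Lit 2)) (RMul (RVar 0) (OfWord (Var 7))))
        (OfWord (WMul (At 10 (Var 5)) (WAdd (WMul (Var 2) (WSub (Var 2) (Lit 1))) (Lit 2))))"
  have "runs W check_balance s ((2 * n - 0) * (Suc 1 + 2) + 2) (J (2 * n))"
    unfolding check_balance_def
  proof (rule runs_For)
    fix i s' assume i: "i < 2 * n" and J: "J i s'" "wget s' 5 0 = i"
    have fr: "frame {5, 13} {} s s'" using J by (simp add: J_def)
    have bad: "tval ?t s' \<longleftrightarrow> bad i"
      unfolding bad_def by (simp add: frame_wget[OF fr] frame_rget[OF fr] par J(2))
    show "runs W (Cond ?t (Assign 13 (Lit 1)) Skip) s' (Suc 1)
        (\<lambda>s'. wget s' 5 0 = i \<and> J (Suc i) (wset 5 0 (Suc i) s'))"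
    proof (cases "bad i")
      case True
      then show ?thesis
        using J W bad by (intro runs_Cond runs_Put) (auto simp: J_def adr_def)
    next
      case False
      then show ?thesis
        using J bad by (intro runs_Cond runs_Skip) (auto simp: J_def less_Suc_eq)
    qed
  qed (use W assms(2) par in \<open>auto simp: J_def frame_wget\<close>)
  then show ?thesis by (rule runs_mono) (auto simp: J_def bad_def)
qed

lemma runs_greedy_round:
  assumes inv: "main_inv H s" and t: "length H + 2 < W"
  shows "runs W greedy_round s (100 * n) (\<lambda>s'. \<exists>h. main_inv (H @ [h]) s')"
proof -
  have par: "parameters (length H) s" and out: "outp s = family_table n H"
    and h_id: "\<And>u. u < q \<Longrightarrow> wget s 8 u = u" and hash: "\<forall>h\<in>set H. hash_function p q n h"
    and pot: "potential p q n x H \<le> real n ^ 2 * (1 + (x - 1) / real q) ^ length H"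
    and rec: "recorded (\<lambda>_. H) s"
    using inv unfolding main_inv_def by auto
  have "runs W greedy_round s (1 + (80 * n + (1 + (1 + ((3 * n + 2) + (8 * n + 2))))))
      (\<lambda>s'. \<exists>h. main_inv (H @ [h]) s')"
    unfolding greedy_round_def
  proof (rule runs_Seq)
    let ?s1 = "wset 4 0 q s"
    have h1: "wget ?s1 8 = wget s 8" and b1: "wget ?s1 4 0 = q" by auto
    have "min n q = q" using q_less by simp
    then have "level_inv H ?s1"
      unfolding level_inv_def h1 b1
    proof (intro conjI)
      \<comment> \<open>All levels are at least \<open>q\<close>, so at the start of a round none of
        them counts the current table.\<close>
      have "recorded (\<lambda>b. if b < q then H @ [wget s 8] else H) ?s1"
        using rec by (auto simp: recorded_def levels_def)
      then show "recorded (\<lambda>b. if b < q then H @ [wget s 8] else H) ?s1" .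
      show "parameters (length H) ?s1" using par by (simp add: parameters_def)
      show "digit_additive p (min n q) (wget s 8)"
        using digit_additive_id[OF p2 h_id q_pos] \<open>min n q = q\<close> by simp
      show "\<exists>k. q = p ^ k" using q by blast
    qed (use out h_id in \<open>auto simp: levels_def\<close>)
    then show "runs W (Assign 4 (Var 1)) s 1 (\<lambda>s'. level_inv H s' \<and> wget s' 4 0 = q)"
      using par W q_less n_less by (intro runs_Put) (auto simp: parameters_def adr_def)
  next
    fix s1 assume s1: "level_inv H s1 \<and> wget s1 4 0 = q"
    show "runs W (Seq (Loop (WLess (Var 4) (Var 0)) process_level)
     (Seq (Assign 7 (WAdd (Var 7) (Lit 1))) (Seq (Assign 13 (Lit 0))
       (Seq print_table check_balance)))) s1 (80 * n + (1 + (1 + ((3 * n + 2) + (8 * n + 2)))))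
      (\<lambda>s'. \<exists>h. main_inv (H @ [h]) s')"
    proof (rule runs_Seq[OF runs_levels])
      fix s2 assume s2: "level_inv H s2 \<and> n \<le> wget s2 4 0"
      define h where "h = wget s2 8"
      have par2: "parameters (length H) s2" and out2: "outp s2 = family_table n H"
        and h: "\<forall>u<n. h u < q" "\<forall>u<q. h u = u" "digit_additive p n h"
        and greedy: "\<And>b. b \<in> levels p q n \<Longrightarrow> greedy_choice q x H h b"
        and rec2: "recorded (\<lambda>b. if b < wget s2 4 0 then H @ [h] else H) s2"
        using s2 unfolding level_inv_def h_def by (auto simp: levels_def min_def)
      have "recorded (\<lambda>_. H @ [h]) s2"
      proof -
        \<comment> \<open>At the end of the loop all levels lie below the current power, so each of
          them counts the new function.\<close>
        have "b < wget s2 4 0" if "b \<in> levels p q n" for b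
          using that s2 by (auto simp: levels_def)
        then show ?thesis using rec2 by (simp add: recorded_def)
      qed
      note rec2 = this
      have hf: "hash_function p q n h" using h by (simp add: hash_function_def)
      have "potential p q n x (H @ [h]) \<le> (1 + (x - 1) / real q) * potential p q n x H"
        using x_gt_1 q_pos greedy by (intro potential_snoc) auto
      also have "\<dots> \<le> (1 + (x - 1) / real q) * (real n ^ 2 * (1 + (x - 1) / real q) ^ length H)"
        using x_gt_1 pot by (intro mult_left_mono) auto
      finally have pot2: "potential p q n x (H @ [h])
          \<le> real n ^ 2 * (1 + (x - 1) / real q) ^ length (H @ [h])"
        by (simp add: ac_simps)
      show "runs W (Seq (Assign 7 (WAdd (Var 7) (Lit 1))) (Seq (Assign 13 (Lit 0))
         (Seq print_table check_balance))) s2 (1 + (1 + ((3 * n + 2) + (8 * n + 2))))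
        (\<lambda>s'. \<exists>h. main_inv (H @ [h]) s')"
      proof (rule runs_Seq)
        show "runs W (Assign 7 (WAdd (Var 7) (Lit 1))) s2 1 (\<lambda>s'. s' = wset 7 0 (length H + 1) s2)"
          using par2 W t by (intro runs_Put) (auto simp: adr_def parameters_def)
      next
        fix s3 assume s3: "s3 = wset 7 0 (length H + 1) s2"
        show "runs W (Seq (Assign 13 (Lit 0)) (Seq print_table check_balance)) s3
          (1 + ((3 * n + 2) + (8 * n + 2))) (\<lambda>s'. \<exists>h. main_inv (H @ [h]) s')"
        proof (rule runs_Seq)
          show "runs W (Assign 13 (Lit 0)) s3 1 (\<lambda>s'. s' = wset 13 0 0 s3)"
            using W by (intro runs_Put) (auto simp: adr_def)
        next
          fix s4 assume s4: "s4 = wset 13 0 0 s3"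
          have par4: "parameters (length (H @ [h])) s4" and out4: "outp s4 = family_table n H"
            and z4: "wget s4 13 0 = 0" and h4: "\<And>u. wget s4 8 u = h u"
            and rec4: "recorded (\<lambda>_. H @ [h]) s4"
            using par2 out2 rec2 by (simp_all add: s3 s4 parameters_def recorded_def h_def)
          have n4: "wget s4 0 0 = n" using par4 by (simp add: parameters_def)
          show "runs W (Seq print_table check_balance) s4
            ((3 * n + 2) + (8 * n + 2)) (\<lambda>s'. \<exists>h. main_inv (H @ [h]) s')"
            unfolding print_table_def
          proof (rule runs_Seq[OF runs_print[where f = h]])
            fix s5 assume s5: "frame {5} {} (s4\<lparr>outp := outp s5\<rparr>) s5 \<and> outp s5 = outp s4 @ map h [0..<n]"
            note f5 = s5[THEN conjunct1]
            have par5: "parameters (length (H @ [h])) s5" and z5: "wget s5 13 0 = 0"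
              and rec5: "recorded (\<lambda>_. H @ [h]) s5" and h5: "\<And>u. wget s5 8 u = h u"
              using par4 z4 rec4 h4
              by (simp_all add: parameters_def recorded_def frame_wget[OF f5] frame_rget[OF f5])
            have out5: "outp s5 = family_table n (H @ [h])"
              using s5 out4 by (simp add: family_table_snoc)
            show "runs W check_balance s5 (8 * n + 2) (\<lambda>s'. \<exists>h. main_inv (H @ [h]) s')"
            proof (rule runs_mono[OF runs_check_balance[OF par5 z5] order_refl])
              fix s6 assume s6: "frame {5, 13} {} s5 s6 \<and> wget s6 13 0 =
                (if \<forall>j<2 * n. \<not> 2 * (\<epsilon> * real (length (H @ [h]))) < real (wget s5 10 j * (d * (d - 1) + 2))
                 then 0 else 1)"
              note f6 = s6[THEN conjunct1]
              have "parameters (length (H @ [h])) s6" "recorded (\<lambda>_. H @ [h]) s6"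
                using par5 rec5
                by (simp_all add: parameters_def recorded_def frame_wget[OF f6] frame_rget[OF f6])
              moreover have "wget s6 13 0 = (if balanced p q n (x / real q) (H @ [h]) then 0 else 1)"
                using s6 unfolding balanced_iff_recorded[OF rec5] by blast
              moreover have "outp s6 = family_table n (H @ [h])" using out5 frame_outp[OF f6] by simp
              moreover have "\<forall>u<q. wget s6 8 u = u" using h5 h(2) by (simp add: frame_wget[OF f6])
              ultimately have "main_inv (H @ [h]) s6"
                using hash hf pot2 unfolding main_inv_def by simp
              then show "\<exists>h. main_inv (H @ [h]) s6" by blast
            qed
          next
            fix i s' assume "frame {5} {} (s4\<lparr>outp := outp s'\<rparr>) s'" "wget s' 5 0 = i"
            then show "wval (At 8 (Var 5)) s' = h i" using h4 by (simp add: frame_wget)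
          qed (use W n4 h n_less q_less in auto)
        qed
      qed
    qed (use s1 t in auto)
  qed
  then show ?thesis by (rule runs_mono) (use q_pos q_less in auto)
qed

lemma runs_prepare: "runs W prepare (input_store n q d \<epsilon>) (14 * n) (main_inv [])"
proof -
  let ?s = "input_store n q d \<epsilon>"
  have wget0: "wget ?s 0 0 = n" "wget ?s (Suc 0) 0 = q" "wget ?s 2 0 = d"
    "\<And>k i. 3 \<le> k \<Longrightarrow> k < 16 \<Longrightarrow> wget ?s k i = 0" "rget ?s 0 0 = \<epsilon>" "outp ?s = []"
    by (auto simp: wget_def rget_def adr_def input_store_def)
  have p_le: "p \<le> q" using q r_pos p2 by (simp add: self_le_power)
  \<comment> \<open>The search cannot pass \<open>p\<close>, because \<open>p\<close> divides
    \<open>q\<close>.\<close>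
  define I where "I s \<longleftrightarrow> frame {3} {} ?s s \<and> 2 \<le> wget s 3 0 \<and> wget s 3 0 \<le> p" for s
  let ?lp = "Loop (WLess (Lit 0) (WMod (Var 1) (Var 3))) (Assign 3 (WAdd (Var 3) (Lit 1)))"
  have "runs W prepare ?s (1 + ((2 * q + 1) + (1 + ((3 * q + 2) + ((6 * n + 2) + 1))))) (main_inv [])"
    unfolding prepare_def
  proof (rule runs_Seq)
    show "runs W (Assign 3 (Lit 2)) ?s 1 I"
      using W p2 by (intro runs_Put) (auto simp: adr_def I_def)
  next
    fix s1 assume s1: "I s1"
    show "runs W (Seq ?lp (Seq (RAssign 1 (RDiv (RMul (RMul (OfWord (Lit 2)) (RVar 0)) (OfWord (Var 1)))
        (OfWord (WAdd (WMul (Var 2) (WSub (Var 2) (Lit 1))) (Lit 2)))))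
     (Seq (For (Lit 0) (Var 1) (Put 8 (Var 5) (Var 5)))
     (Seq (For (Lit 0) (WMul (Lit 2) (Var 0)) (RPut 2 (Var 5) (OfWord (Lit 1))))
       (Assign 13 (Lit 1)))))) s1 ((2 * q + 1) + (1 + ((3 * q + 2) + ((6 * n + 2) + 1)))) (main_inv [])"
    proof (rule runs_Seq)
      define f where "f s = 2 * (p - wget s 3 0)" for s
      have q1: "wget s 1 0 = q" if "I s" for s
        using frame_wget[of "{3}" "{}" ?s s 1 0] that wget0 by (simp add: I_def)
      have "runs W ?lp s1 (f s1 + 1) (\<lambda>s'. I s' \<and> \<not> tval (WLess (Lit 0) (WMod (Var 1) (Var 3))) s')"
      proof (rule runs_Loop[where I = I])
        show "I s1" by (rule s1)
      next
        fix s assume s: "I s" "tval (WLess (Lit 0) (WMod (Var 1) (Var 3))) s"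
        have "q mod p = 0" using q r_pos by simp
        then have "wget s 3 0 \<noteq> p" using s q1[OF s(1)] by auto
        then have "wget s 3 0 < p" using s by (simp add: I_def)
        then have "runs W (Assign 3 (WAdd (Var 3) (Lit 1))) s 1 (\<lambda>s'. I s' \<and> 1 + f s' < f s)"
          using s W p_le q_less by (intro runs_Put) (auto simp: I_def f_def adr_def)
        then show "\<exists>\<tau>. runs W (Assign 3 (WAdd (Var 3) (Lit 1))) s \<tau> (\<lambda>s'. I s' \<and> \<tau> + f s' < f s)"
          by blast
      qed
      then show "runs W ?lp s1 (2 * q + 1) (\<lambda>s'. frame {3} {} ?s s' \<and> wget s' 3 0 = p)"
      proof (rule runs_mono)
        fix s' assume s': "I s' \<and> \<not> tval (WLess (Lit 0) (WMod (Var 1) (Var 3))) s'"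
        then have dvd: "wget s' 3 0 dvd p ^ r" using q1[of s'] q by auto
        have bounds: "2 \<le> wget s' 3 0" "wget s' 3 0 \<le> p" using s' by (auto simp: I_def)
        \<comment> \<open>A divisor of \<open>p ^ r\<close> is a power of \<open>p\<close>, and the
          only one from 2 to \<open>p\<close> is \<open>p\<close> itself.\<close>
        obtain i where i: "wget s' 3 0 = p ^ i"
          using dvd divides_primepow_nat[OF prime] by blast
        with bounds have "i \<noteq> 0" by (intro notI) simp
        then have "p \<le> p ^ i" using p2 by (intro self_le_power) auto
        then show "frame {3} {} ?s s' \<and> wget s' 3 0 = p" using s' i bounds by (simp add: I_def)
      qed (use p_le in \<open>simp add: f_def\<close>)
    next
      fix s2 assume s2: "frame {3} {} ?s s2 \<and> wget s2 3 0 = p"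
      note f2 = s2[THEN conjunct1]
      show "runs W (Seq (RAssign 1 (RDiv (RMul (RMul (OfWord (Lit 2)) (RVar 0)) (OfWord (Var 1)))
          (OfWord (WAdd (WMul (Var 2) (WSub (Var 2) (Lit 1))) (Lit 2)))))
       (Seq (For (Lit 0) (Var 1) (Put 8 (Var 5) (Var 5)))
       (Seq (For (Lit 0) (WMul (Lit 2) (Var 0)) (RPut 2 (Var 5) (OfWord (Lit 1))))
         (Assign 13 (Lit 1))))) s2 (1 + ((3 * q + 2) + ((6 * n + 2) + 1))) (main_inv [])"
      proof (rule runs_Seq)
        have P: "real (d * (d - 1) + 2) = 2 * pairs_plus_one d" by (rule two_pairs_plus_one[OF d_pos])
        have "2 * \<epsilon> * real q / real (d * (d - 1) + 2) = x"
          unfolding P x by simp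
        then have "rval (RDiv (RMul (RMul (OfWord (Lit 2)) (RVar 0)) (OfWord (Var 1)))
            (OfWord (WAdd (WMul (Var 2) (WSub (Var 2) (Lit 1))) (Lit 2)))) s2 = x"
          by (simp add: frame_wget[OF f2] frame_rget[OF f2] wget0)
        then show "runs W (RAssign 1 (RDiv (RMul (RMul (OfWord (Lit 2)) (RVar 0)) (OfWord (Var 1)))
            (OfWord (WAdd (WMul (Var 2) (WSub (Var 2) (Lit 1))) (Lit 2))))) s2 1
            (\<lambda>s'. s' = rset 1 0 x s2)"
          using W by (intro runs_RPut) (auto simp: adr_def)
      next
        fix s3 assume s3: "s3 = rset 1 0 x s2"
        have f3: "frame {3} {1} ?s s3" using f2 unfolding s3 by (simp add: frame_def)
        have s3': "wget s3 3 0 = p" "rget s3 1 0 = x" using s2 by (simp_all add: s3)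
        show "runs W (Seq (For (Lit 0) (Var 1) (Put 8 (Var 5) (Var 5)))
         (Seq (For (Lit 0) (WMul (Lit 2) (Var 0)) (RPut 2 (Var 5) (OfWord (Lit 1))))
           (Assign 13 (Lit 1)))) s3 ((3 * q + 2) + ((6 * n + 2) + 1)) (main_inv [])"
        proof (rule runs_Seq)
          define J where "J i s' \<longleftrightarrow> frame {5, 8} {} s3 s' \<and> (\<forall>u<i. wget s' 8 u = u)" for i s'
          have "runs W (For (Lit 0) (Var 1) (Put 8 (Var 5) (Var 5))) s3 ((q - 0) * (1 + 2) + 2) (J q)"
          proof (rule runs_For)
            fix i s' assume "i < q" "J i s'" "wget s' 5 0 = i"
            then show "runs W (Put 8 (Var 5) (Var 5)) s' 1
                (\<lambda>s'. wget s' 5 0 = i \<and> J (Suc i) (wset 5 0 (Suc i) s'))"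
              using q_less n_less by (intro runs_Put) (auto simp: J_def less_Suc_eq intro!: adr_less)
          next
            fix i s' assume "J i s'"
            then have f': "frame {5, 8} {} s3 s'" by (simp add: J_def)
            show "wval (Var 1) s' = q"
              using wget0 by (simp add: frame_wget[OF f'] frame_wget[OF f3])
          qed (use W q_less in \<open>auto simp: J_def\<close>)
          then show "runs W (For (Lit 0) (Var 1) (Put 8 (Var 5) (Var 5))) s3 (3 * q + 2) (J q)"
            by (rule runs_mono) auto
          fix s4 assume "J q s4"
          then have f4: "frame {5, 8} {} s3 s4" and id4: "\<forall>u<q. wget s4 8 u = u"
            by (auto simp: J_def)
          note f4' = frame_trans[OF f3 f4]
          have s4: "wget s4 3 0 = p" "rget s4 1 0 = x"
            using s3' by (simp_all add: frame_wget[OF f4] frame_rget[OF f4])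
          show "runs W (Seq (For (Lit 0) (WMul (Lit 2) (Var 0)) (RPut 2 (Var 5) (OfWord (Lit 1))))
             (Assign 13 (Lit 1))) s4 ((6 * n + 2) + 1) (main_inv [])"
          proof (rule runs_Seq)
            define K where "K i s' \<longleftrightarrow> frame {5} {2} s4 s' \<and> (\<forall>u<i. rget s' 2 u = 1)" for i s'
            have "runs W (For (Lit 0) (WMul (Lit 2) (Var 0)) (RPut 2 (Var 5) (OfWord (Lit 1)))) s4
                ((2 * n - 0) * (1 + 2) + 2) (K (2 * n))"
            proof (rule runs_For)
              fix i s' assume "i < 2 * n" "K i s'" "wget s' 5 0 = i"
              then show "runs W (RPut 2 (Var 5) (OfWord (Lit 1))) s' 1
                  (\<lambda>s'. wget s' 5 0 = i \<and> K (Suc i) (wset 5 0 (Suc i) s'))"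
                by (intro runs_RPut) (auto simp: K_def less_Suc_eq intro!: adr_less)
            next
              fix i s' assume "K i s'"
              then have f': "frame {5} {2} s4 s'" by (simp add: K_def)
              show "wval (WMul (Lit 2) (Var 0)) s' = 2 * n"
                using wget0 by (simp add: frame_wget[OF f'] frame_wget[OF f4'])
            qed (use W in \<open>auto simp: K_def\<close>)
            then show "runs W (For (Lit 0) (WMul (Lit 2) (Var 0)) (RPut 2 (Var 5) (OfWord (Lit 1)))) s4
                (6 * n + 2) (K (2 * n))"
              by (rule runs_mono) auto
            fix s5 assume "K (2 * n) s5"
            then have f5: "frame {5} {2} s4 s5" and w5: "\<And>u. u < 2 * n \<Longrightarrow> rget s5 2 u = 1"
              by (auto simp: K_def)
            note f5' = frame_trans[OF f4' f5]
            let ?s6 = "wset 13 0 1 s5"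
            have "parameters 0 ?s6"
              using wget0 s4 by (simp add: parameters_def frame_wget[OF f5'] frame_rget[OF f5']
                  frame_wget[OF f5] frame_rget[OF f5])
            moreover have "outp ?s6 = []" using wget0 by (simp add: frame_outp[OF f5'])
            moreover have "\<forall>u<q. wget ?s6 8 u = u" using id4 by (simp add: frame_wget[OF f5])
            \<comment> \<open>The counters are 0 from the input store on, and the prepared weights
              are \<open>x ^ 0 = 1\<close>.\<close>
            moreover have "recorded (\<lambda>_. []) ?s6"
              using wget0 w5 by (auto simp: recorded_def frame_wget[OF f5'] levels_def)
            ultimately have "main_inv [] ?s6"
              using potential_Nil by (simp add: main_inv_def family_table_def)
            then show "runs W (Assign 13 (Lit 1)) s5 1 (main_inv [])"
              using W by (intro runs_Put) (auto simp: adr_def)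
          qed
        qed
      qed
    qed
  qed
  then show ?thesis by (rule runs_mono) (use q_pos q_less in auto)
qed

end

section \<open>Number of rounds and the resulting family\<close>

context greedy_hashing
begin

text \<open>A lower bound for how much faster, per function, the log weight of an overloaded pair
  grows than the bound on the potential; an unbalanced family has fewer than
  \<open>2 * ln n / rate\<close> members.\<close>

definition rate :: real where
  "rate = x / real q * (ln x - 1 + 1 / x)"

lemma rate_pos: "rate > 0"
proof -
  have "(1 - 1 / x) ^ 2 / 2 > 0" using x_gt_1 by simp
  then have "ln x - 1 + 1 / x > 0" using ln_ge_quadratic[of x] x_gt_1 by linarith
  then show ?thesis using x_gt_1 q_pos by (simp add: rate_def)
qed

text \<open>\<open>runs_Loop\<close> fixes the word bound, whereas here it refers to the final
  length. Therefore the induction is on the number of rounds that may still follow, and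
  \<open>exec_mono\<close> lifts each round to the final bound.\<close>

lemma exec_main_loop:
  assumes "main_inv H s" "(real (length H) - 1) * rate \<le> 2 * ln (real n)"
  shows "\<exists>H' s' t. main_inv H' s' \<and> H' \<noteq> [] \<and> balanced p q n (x / real q) H' \<and>
    (real (length H') - 1) * rate \<le> 2 * ln (real n) \<and> length H \<le> length H' \<and>
    t \<le> (length H' - length H) * (100 * n + 1) + 1 \<and>
    exec (32 * n + n * q + length H' + 19) (Loop (WLess (Lit 0) (Var 13)) greedy_round) s t s'"
  using assms
proof (induction "nat \<lceil>2 * ln (real n) / rate\<rceil> + 1 - length H" arbitrary: H s rule: less_induct)
  case less
  let ?L = "Loop (WLess (Lit 0) (Var 13)) greedy_round" and ?W = "\<lambda>m. 32 * n + n * q + m + 19"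
  show ?case
  proof (cases "H \<noteq> [] \<and> balanced p q n (x / real q) H")
    case True
    then have "exec (?W (length H)) ?L s 1 s"
      using less.prems(1) by (intro exec_LoopF) (simp add: main_inv_def)
    with True less.prems show ?thesis by (intro exI[of _ H] exI[of _ s] exI[of _ 1]) simp
  next
    case False
    then have flag: "tval (WLess (Lit 0) (Var 13)) s" using less.prems(1) by (auto simp: main_inv_def)
    \<comment> \<open>A list that has not passed the test is empty or unbalanced and hence short;
      this is the length condition for the list with one more function.\<close>
    have len: "real (length H) * rate \<le> 2 * ln (real n)"
    proof (cases "H = []")
      case True
      then show ?thesis using q_less by simp
    next
      case nonempty: False
      with False have "\<not> balanced p q n (x / real q) H" by simp
      then show ?thesis
        using length_of_unbalanced[of x q n p H] less.prems(1) x_gt_1 q_pos q_less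
        by (simp add: main_inv_def rate_def)
    qed
    then have "real (length H) \<le> 2 * ln (real n) / rate" using rate_pos by (simp add: pos_le_divide_eq)
    then have M: "length H \<le> nat \<lceil>2 * ln (real n) / rate\<rceil>" by linarith
    interpret bounded_greedy_hashing n q p r d \<epsilon> x "?W (length H)"
      by unfold_locales auto
    have "runs (?W (length H)) greedy_round s (100 * n) (\<lambda>s'. \<exists>h. main_inv (H @ [h]) s')"
      using less.prems(1) by (intro runs_greedy_round) auto
    then obtain t1 s1 h where 1: "exec (?W (length H)) greedy_round s t1 s1" "t1 \<le> 100 * n"
      "main_inv (H @ [h]) s1" by (auto simp: runs_def)
    obtain H' s' t where 2: "main_inv H' s'" "H' \<noteq> []" "balanced p q n (x / real q) H'"
      "(real (length H') - 1) * rate \<le> 2 * ln (real n)" "length (H @ [h]) \<le> length H'"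
      "t \<le> (length H' - length (H @ [h])) * (100 * n + 1) + 1" "exec (?W (length H')) ?L s1 t s'"
      using less.hyps[OF _ 1(3)] len M by fastforce
    have "exec (?W (length H')) greedy_round s t1 s1"
      by (rule exec_mono[OF 1(1)]) (use 2(5) in simp)
    then have "exec (?W (length H')) ?L s (Suc (t1 + t)) s'"
      using flag 2(7) by (intro exec_LoopT)
    moreover have "Suc (t1 + t) \<le> (length H' - length H) * (100 * n + 1) + 1"
    proof -
      have "length H' - length H = Suc (length H' - length (H @ [h]))" using 2(5) by simp
      then show ?thesis using 1(2) 2(6) by simp
    qed
    ultimately show ?thesis
      using 2 by (intro exI[of _ H'] exI[of _ s'] exI[of _ "Suc (t1 + t)"]) simp
  qed
qed

lemma greedy_family_exists:
  assumes "\<epsilon> < 1"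
  shows "\<exists>H t s. dense_phf (1 - \<epsilon>) n q d H \<and> (real (length H) - 1) * rate \<le> 2 * ln (real n) \<and>
    exec (32 * n + n * q + length H + 19) dense_phf_program (input_store n q d \<epsilon>) t s \<and>
    outp s = family_table n H \<and> t \<le> 16 * n + length H * (100 * n + 1) + 1"
proof -
  let ?W = "\<lambda>m. 32 * n + n * q + m + 19"
  interpret bounded_greedy_hashing n q p r d \<epsilon> x "?W 0"
    by unfold_locales auto
  have "runs (?W 0) prepare (input_store n q d \<epsilon>) (14 * n) (main_inv [])"
    by (rule runs_prepare)
  then obtain t1 s1 where 1: "exec (?W 0) prepare (input_store n q d \<epsilon>) t1 s1" "t1 \<le> 14 * n"
    "main_inv [] s1" by (auto simp: runs_def)
  \<comment> \<open>For the empty list the left side is \<open>- rate\<close>, hence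
    negative.\<close>
  have "(real (length []) - 1) * rate \<le> 2 * ln (real n)"
    using rate_pos q_less by (simp add: order_trans[of "- rate" 0])
  from exec_main_loop[OF 1(3) this] obtain H s t where 2: "main_inv H s" "H \<noteq> []"
    "balanced p q n (x / real q) H" "(real (length H) - 1) * rate \<le> 2 * ln (real n)"
    "t \<le> length H * (100 * n + 1) + 1"
    "exec (?W (length H)) (Loop (WLess (Lit 0) (Var 13)) greedy_round) s1 t s"
    by auto
  have x_div_q: "x / real q = \<epsilon> / pairs_plus_one d" using q_pos by (simp add: x)
  have "dense_phf (1 - \<epsilon>) n q d H"
  proof (rule dense_phf_of_balanced[OF prime 2(2) eps_pos pairs_plus_one_pos])
    show "balanced p q n (\<epsilon> / pairs_plus_one d) H" using 2(3) unfolding x_div_q .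
  qed (use 2(1) q_less in \<open>auto simp: main_inv_def\<close>)
  moreover have "exec (?W (length H)) prepare (input_store n q d \<epsilon>) t1 s1"
    using 1(1) by (rule exec_mono) simp
  then have "exec (?W (length H)) dense_phf_program (input_store n q d \<epsilon>) (Suc (Suc (t1 + t))) s"
    unfolding dense_phf_program_def using 2(6) q_less assms
    by (intro exec_CondT exec_Seq) (auto simp: wget_def rget_def adr_def input_store_def)
  moreover have "outp s = family_table n H" using 2(1) by (simp add: main_inv_def)
  moreover have "Suc (Suc (t1 + t)) \<le> 16 * n + length H * (100 * n + 1) + 1"
    using 1(2) 2(5) q_less by simp
  ultimately show ?thesis using 2(4) by blast
qed

end

text \<open>One constant serves as exponent of the word bound and as time factor. The estimates give
  exponent 4, where \<open>N >= 4\<close> absorbs the constants, and factor 118; \<open>200\<close>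
  covers both.\<close>

lemma constructs_in_linear_time_I:
  assumes "n > 0" "q \<ge> 2" "H \<noteq> []"
    and run: "exec (32 * n + n * q + length H + 19) P (input_store n q d \<epsilon>) t s"
    and out: "outp s = family_table n H" and t: "t \<le> 16 * n + length H * (100 * n + 1) + 1"
  shows "constructs_in_linear_time 200 P n q d \<epsilon> H"
proof -
  define N m where "N = n + q + length H" and "m = length H"
  have m: "m \<ge> 1" using assms(3) by (cases H) (auto simp: m_def)
  then have N: "N \<ge> 4" using assms(1,2) by (simp add: N_def m_def)
  have sq: "N * N \<ge> 4 * N" using N by simp
  have "n * q \<le> N * N" by (intro mult_mono) (auto simp: N_def)
  moreover have "32 * n + length H + 19 \<le> 32 * N + 19" using assms(2) by (simp add: N_def)
  ultimately have "32 * n + n * q + length H + 19 \<le> 16 * (N * N)" using sq N by linarith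
  also have "\<dots> \<le> (N * N) * (N * N)" using mult_le_mono[OF N N] by (intro mult_right_mono) auto
  also have "\<dots> = N ^ 4" by (simp add: power4_eq_xxxx)
  also have "\<dots> \<le> N ^ 200" using N by (intro power_increasing) auto
  finally have "exec (N ^ 200) P (input_store n q d \<epsilon>) t s" by (rule exec_mono[OF run])
  moreover have "t \<le> 200 * (m * n)"
  proof -
    have "n \<le> m * n" "m \<le> m * n" "1 \<le> m * n" using m assms(1) by auto
    moreover have "t \<le> 16 * n + 100 * (m * n) + m + 1" using t by (simp add: m_def algebra_simps)
    ultimately show ?thesis by linarith
  qed
  ultimately show ?thesis
    unfolding constructs_in_linear_time_def N_def m_def using out by blast
qed

text \<open>This treats the two branches that print a single table. The assumption on
  \<open>P\<close> says that it reaches the printing loop after one test, as for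
  \<open>n <= q\<close>, or after two, as for \<open>\<epsilon> >= 1\<close>.\<close>

lemma single_function_family:
  assumes "n > 0" "q \<ge> 2" and h: "h \<in> {..<n} \<rightarrow> {..<q}" and eps: "\<epsilon> \<ge> 0" "\<epsilon> < 1 \<Longrightarrow> inj_on h {..<n}"
    and e: "\<And>i s. i < n \<Longrightarrow> wget s 5 0 = i \<Longrightarrow> wval e s = h i"
    and P: "\<And>W t s. exec W (For (Lit 0) (Var 0) (Out e)) (input_store n q d \<epsilon>) t s \<Longrightarrow>
      exec W P (input_store n q d \<epsilon>) (t + 2) s \<or> exec W P (input_store n q d \<epsilon>) (t + 1) s"
  shows "dense_phf (1 - \<epsilon>) n q d [h]" "constructs_in_linear_time 200 P n q d \<epsilon> [h]"
proof -
  show "dense_phf (1 - \<epsilon>) n q d [h]"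
    unfolding dense_phf_def
  proof (intro conjI ballI allI impI)
    fix S assume "S \<subseteq> {..<n}"
    then show "(1 - \<epsilon>) * real (length [h]) \<le> real (length (filter (\<lambda>h. inj_on h S) [h]))"
      using eps inj_on_subset[of h "{..<n}" S] by (cases "\<epsilon> < 1") auto
  qed (use h in auto)
  let ?s = "input_store n q d \<epsilon>" and ?W = "32 * n + n * q + length [h] + 19"
  have "runs ?W (For (Lit 0) (Var 0) (Out e)) ?s (3 * n + 2) (\<lambda>s'.
      frame {5} {} (?s\<lparr>outp := outp s'\<rparr>) s' \<and> outp s' = outp ?s @ map h [0..<n])"
  proof (rule runs_print)
    fix i assume i: "i < n"
    then have "h i < q" using h by auto
    also have "1 * q \<le> n * q" using assms(1) by (intro mult_right_mono) auto
    finally show "h i < ?W" by simp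
  qed (use e in \<open>auto simp: wget_def adr_def input_store_def\<close>)
  then obtain t s where 1: "exec ?W (For (Lit 0) (Var 0) (Out e)) ?s t s" "t \<le> 3 * n + 2"
    "outp s = map h [0..<n]" by (auto simp: runs_def input_store_def)
  obtain t' where "exec ?W P ?s t' s" "t' \<le> t + 2" using P[OF 1(1)] by force
  then show "constructs_in_linear_time 200 P n q d \<epsilon> [h]"
    using assms(1,2) 1(2,3) by (intro constructs_in_linear_time_I) (auto simp: family_table_def)
qed

text \<open>The length bound is kept in terms of \<open>x\<close>, from which both size bounds
  follow. For a single function its left side is 0.\<close>

lemma dense_phf_program_correct:
  assumes q: "primepow q" and n: "n > 0" and d: "d > 0" "d \<le> q" and eps: "\<epsilon> > 0"
    and x: "x = \<epsilon> * real q / pairs_plus_one d" "x > 1"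
  shows "\<exists>H. dense_phf (1 - \<epsilon>) n q d H \<and> H \<noteq> [] \<and>
    (real (length H) - 1) * (x / real q * (ln x - 1 + 1 / x)) \<le> 2 * ln (real n) \<and>
    constructs_in_linear_time 200 dense_phf_program n q d \<epsilon> H"
proof -
  have q2: "q \<ge> 2" using primepow_gt_Suc_0[OF q] by simp
  have input: "words (input_store n q d \<epsilon>) 0 = n" "words (input_store n q d \<epsilon>) (Suc 0) = q"
    "reals (input_store n q d \<epsilon>) 0 = \<epsilon>" by (auto simp: input_store_def)
  consider "n \<le> q" | "q < n" "\<epsilon> \<ge> 1" | "q < n" "\<epsilon> < 1" by linarith
  then show ?thesis
  proof cases
    case 1
    have "exec W dense_phf_program (input_store n q d \<epsilon>) (t + 1) s"
      if "exec W (For (Lit 0) (Var 0) (Out (Var 5))) (input_store n q d \<epsilon>) t s" for W t s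
      unfolding dense_phf_program_def using exec_CondF[OF _ that] 1 input
      by (simp add: wget_def adr_def)
    note * = single_function_family[of n q "\<lambda>i. i" \<epsilon> "Var 5" d dense_phf_program,
        OF n q2 _ _ _ _ disjI2[OF this]]
    show ?thesis using * 1 n eps by (intro exI[of _ "[\<lambda>i. i]"]) auto
  next
    case 2
    have "exec W dense_phf_program (input_store n q d \<epsilon>) (t + 2) s"
      if "exec W (For (Lit 0) (Var 0) (Out (Lit 0))) (input_store n q d \<epsilon>) t s" for W t s
      unfolding dense_phf_program_def
      using exec_CondT[OF _ exec_CondF[OF _ that]] 2 input by (simp add: wget_def rget_def adr_def)
    note * = single_function_family[of n q "\<lambda>i. 0" \<epsilon> "Lit 0" d dense_phf_program,
        OF n q2 _ _ _ _ disjI1[OF this]]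
    show ?thesis using * 2 n q2 by (intro exI[of _ "[\<lambda>i. 0]"]) auto
  next
    case 3
    obtain p r where pr: "prime p" "r > 0" "q = p ^ r" using q by (auto simp: primepow_def)
    interpret greedy_hashing n q p r d \<epsilon> x
      using 3 pr d eps x by unfold_locales
    obtain H t s where H: "dense_phf (1 - \<epsilon>) n q d H" "(real (length H) - 1) * rate \<le> 2 * ln (real n)"
      "exec (32 * n + n * q + length H + 19) dense_phf_program (input_store n q d \<epsilon>) t s"
      "outp s = family_table n H" "t \<le> 16 * n + length H * (100 * n + 1) + 1"
      using greedy_family_exists[OF 3(2)] by blast
    have "H \<noteq> []" using H(1) by (simp add: dense_phf_def)
    then show ?thesis
      using H constructs_in_linear_time_I[OF n q2 _ H(3-5)] unfolding rate_def by blast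
  qed
qed

theorem theorem3:
  shows "(\<exists>P C c. \<forall>(n::nat) (q::nat) (d::nat) (\<epsilon>::real).
            primepow q \<longrightarrow> n > 0 \<longrightarrow> d > 0 \<longrightarrow> d \<le> q \<longrightarrow> \<epsilon> > 0 \<longrightarrow>
            \<epsilon> > 4 * pairs_plus_one d / real q \<longrightarrow>
            (\<exists>H. dense_phf (1 - \<epsilon>) n q d H \<and>
                 real (length H) \<le> C * max 1 (size_large_eps n q d \<epsilon>) \<and>
                 constructs_in_linear_time c P n q d \<epsilon> H))
       \<and> (\<exists>P C c. \<forall>(n::nat) (q::nat) (d::nat) (\<epsilon>::real).
            primepow q \<longrightarrow> n > 0 \<longrightarrow> d > 0 \<longrightarrow> d \<le> q \<longrightarrow> \<epsilon> > 0 \<longrightarrow>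
            pairs_plus_one d / (real q - 1) \<le> \<epsilon> \<longrightarrow> \<epsilon> \<le> 4 * pairs_plus_one d / real q \<longrightarrow>
            (\<exists>H. dense_phf (1 - \<epsilon>) n q d H \<and>
                 real (length H) \<le> C * max 1 (size_small_eps n q d \<epsilon>) \<and>
                 constructs_in_linear_time c P n q d \<epsilon> H))"
proof (rule conjI; rule exI[of _ dense_phf_program], rule exI[of _ 5], rule exI[of _ 200],
    intro allI impI)
  fix n q d :: nat and \<epsilon> :: real
  assume A: "primepow q" "n > 0" "d > 0" "d \<le> q" "\<epsilon> > 0" and large: "\<epsilon> > 4 * pairs_plus_one d / real q"
  define x where "x = \<epsilon> * real q / pairs_plus_one d"
  have q: "q > 0" using A by simp
  have P: "pairs_plus_one d > 0" by (rule pairs_plus_one_pos)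
  \<comment> \<open>The hypothesis on \<open>\<epsilon>\<close>, rewritten for
    \<open>x\<close>.\<close>
  have "x > 4" using large q P by (simp add: x_def field_simps)
  then obtain H where H: "dense_phf (1 - \<epsilon>) n q d H" "H \<noteq> []"
    "(real (length H) - 1) * (x / real q * (ln x - 1 + 1 / x)) \<le> 2 * ln (real n)"
    "constructs_in_linear_time 200 dense_phf_program n q d \<epsilon> H"
    using dense_phf_program_correct[OF A x_def] by auto
  have "real (length H) \<ge> 1" using H(2) by (cases H) auto
  from length_le_large[OF A(3,5,2) q x_def H(3) this large] H
  show "\<exists>H. dense_phf (1 - \<epsilon>) n q d H \<and> real (length H) \<le> 5 * max 1 (size_large_eps n q d \<epsilon>) \<and>
      constructs_in_linear_time 200 dense_phf_program n q d \<epsilon> H" by blast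
next
  fix n q d :: nat and \<epsilon> :: real
  assume A: "primepow q" "n > 0" "d > 0" "d \<le> q" "\<epsilon> > 0" and small: "pairs_plus_one d / (real q - 1) \<le> \<epsilon>"
  define x where "x = \<epsilon> * real q / pairs_plus_one d"
  have q: "q > 1" using primepow_gt_Suc_0[OF A(1)] by simp
  have P: "pairs_plus_one d > 0" by (rule pairs_plus_one_pos)
  \<comment> \<open>Passing from \<open>q - 1\<close> to \<open>q\<close> makes the inequality
    strict, which yields \<open>x > 1\<close>.\<close>
  have "pairs_plus_one d \<le> \<epsilon> * (real q - 1)" using small q by (simp add: pos_divide_le_eq)
  also have "\<dots> < \<epsilon> * real q" using A(5) by simp
  finally have x1: "x > 1" using P by (simp add: x_def)
  then obtain H where H: "dense_phf (1 - \<epsilon>) n q d H" "H \<noteq> []"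
    "(real (length H) - 1) * (x / real q * (ln x - 1 + 1 / x)) \<le> 2 * ln (real n)"
    "constructs_in_linear_time 200 dense_phf_program n q d \<epsilon> H"
    using dense_phf_program_correct[OF A x_def] by auto
  have "real (length H) \<ge> 1" using H(2) by (cases H) auto
  from length_le_small[OF A(3,5,2) _ x_def H(3) this x1] H q
  show "\<exists>H. dense_phf (1 - \<epsilon>) n q d H \<and> real (length H) \<le> 5 * max 1 (size_small_eps n q d \<epsilon>) \<and>
      constructs_in_linear_time 200 dense_phf_program n q d \<epsilon> H" by auto
qed

end
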